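(* Let $M$ be a commutative monoid, $S\subseteq M$ a finite subset, $X$ a bounded-to-one Borel $M$-set, and $k$ a positive integer. If the Schreier graph $G_S^X$ has a (not necessarily Borel) proper $k$-coloring, then it has a Borel proper $(2k-1)$-coloring. In particular, if $d\in\mathbb N$, $X$ is a free bounded-to-one Borel $\mathbb N^d$-set and $S=\{e_0,\dots,e_{d-1}\}$ is the usual generating set of $\mathbb N^d$, then $G_S^X$ admits a Borel proper $3$-coloring.
   Context: A Borel $M$-set is a standard Borel space $X$ with an action of $M$ such that each map $x\mapsto mx$ is Borel. It is bounded-to-one if for every $m\in M$ there is $k_m\in\mathbb N$ bounding the size of every fiber of $x\mapsto mx$. It is free if $mx=nx$ implies $m=n$ for all $x\in X$, $m,n\in M$. The Schreier graph $G_S^X$ is the graph on $X$ in which distinct points $x,y$ are adjacent iff $y=sx$ or $x=sy$ for some $s\in S$. A proper $k$-coloring is a map from the vertices to a $k$-element set giving adjacent vertices different values; it is Borel if the map is Borel. *)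

theory Defs
  imports "HOL-Analysis.Analysis" "HOL-Algebra.Group"
begin

definition standard_borel :: "'x measure \<Rightarrow> bool" where
  "standard_borel X \<longleftrightarrow>
     (\<exists>T. completely_metrizable_space T \<and> second_countable T \<and>
          topspace T = space X \<and> sets X = sigma_sets (space X) {U. openin T U})"

text \<open>As usual in HOL-Analysis, a measurable space is represented by a value of type
  \<^typ>\<open>'x measure\<close>, whose measure component plays no role here.\<close>

locale borel_mset = Group.monoid M for M (structure) +
  fixes X :: "'x measure" and act :: "'m \<Rightarrow> 'x \<Rightarrow> 'x"
  assumes standard_borel: "standard_borel X"
    and act_borel: "m \<in> carrier M \<Longrightarrow> act m \<in> measurable X X"
    and act_one: "x \<in> space X \<Longrightarrow> act \<one> x = x"
    and act_mult: "\<lbrakk>m \<in> carrier M; n \<in> carrier M; x \<in> space X\<rbrakk>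
                     \<Longrightarrow> act (m \<otimes> n) x = act m (act n x)"

definition bounded_to_one ::
  "'m monoid \<Rightarrow> 'x measure \<Rightarrow> ('m \<Rightarrow> 'x \<Rightarrow> 'x) \<Rightarrow> bool" where
  "bounded_to_one M X act \<longleftrightarrow>
     (\<forall>m\<in>carrier M. \<exists>b::nat. \<forall>y\<in>space X.
        finite {x\<in>space X. act m x = y} \<and> card {x\<in>space X. act m x = y} \<le> b)"

definition free_action ::
  "'m monoid \<Rightarrow> 'x measure \<Rightarrow> ('m \<Rightarrow> 'x \<Rightarrow> 'x) \<Rightarrow> bool" where
  "free_action M X act \<longleftrightarrow>
     (\<forall>x\<in>space X. \<forall>m\<in>carrier M. \<forall>n\<in>carrier M. act m x = act n x \<longrightarrow> m = n)"

text \<open>A graph is given by its vertex set and its symmetric, irreflexive adjacency relation.\<close>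

definition schreier_graph ::
  "'m set \<Rightarrow> 'x measure \<Rightarrow> ('m \<Rightarrow> 'x \<Rightarrow> 'x) \<Rightarrow> ('x \<times> 'x) set" where
  "schreier_graph S X act =
     {(x, y). x \<in> space X \<and> y \<in> space X \<and> x \<noteq> y \<and> (\<exists>s\<in>S. y = act s x \<or> x = act s y)}"

definition proper_coloring ::
  "'x set \<Rightarrow> ('x \<times> 'x) set \<Rightarrow> nat \<Rightarrow> ('x \<Rightarrow> nat) \<Rightarrow> bool" where
  "proper_coloring V E k c \<longleftrightarrow> c \<in> V \<rightarrow> {..<k} \<and> (\<forall>(x, y)\<in>E. c x \<noteq> c y)"

definition borel_proper_coloring ::
  "'x measure \<Rightarrow> ('x \<times> 'x) set \<Rightarrow> nat \<Rightarrow> ('x \<Rightarrow> nat) \<Rightarrow> bool" where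
  "borel_proper_coloring X E k c \<longleftrightarrow>
     proper_coloring (space X) E k c \<and> c \<in> measurable X (count_space {..<k})"

text \<open>The additive monoid of \<open>d\<close>-tuples of natural numbers, written multiplicatively as
  HOL-Algebra requires. Tuples are extensional functions on \<open>{..<d}\<close>, so that each tuple has a
  unique representative.\<close>

definition nat_tuples :: "nat \<Rightarrow> (nat \<Rightarrow> nat) monoid" where
  "nat_tuples d =
     \<lparr>carrier = PiE {..<d} (\<lambda>_. UNIV),
      monoid.mult = (\<lambda>v w. \<lambda>i\<in>{..<d}. v i + w i),
      one = (\<lambda>i\<in>{..<d}. 0)\<rparr>"

definition std_generator :: "nat \<Rightarrow> nat \<Rightarrow> nat \<Rightarrow> nat" where
  "std_generator d i = (\<lambda>j\<in>{..<d}. if j = i then 1 else 0)"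

lemma comm_monoid_nat_tuples: "Group.comm_monoid (nat_tuples d)"
  by unfold_locales
     (auto simp: nat_tuples_def add.assoc add.commute PiE_def extensional_def restrict_def fun_eq_iff)

lemma std_generator_in_nat_tuples: "std_generator d i \<in> carrier (nat_tuples d)"
  by (simp add: std_generator_def nat_tuples_def)

end

theory Submission
  imports Defs "HOL-Library.Function_Algebras" "HOL-Algebra.FiniteProduct"
begin

text \<open>Two Borel \<open>k\<close>-colorings on overlapping regions combine into one with \<open>2 * k - 1\<close> colors. Let \<open>W\<close> be a
set of walls and let \<open>Z\<close> contain \<open>W\<close> and all neighbours of \<open>W\<close>. Suppose that \<open>c0\<close> is proper on the
edges outside \<open>W\<close> and \<open>c1\<close> on the edges inside \<open>Z\<close>. Use \<open>c0\<close> off \<open>Z\<close>; on \<open>Z\<close> use the new color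
\<open>k - 1 + c1\<close> if \<open>c1\<close> is nonzero, and otherwise \<open>0\<close> on \<open>W\<close> and \<open>c0\<close> on the rest of \<open>Z\<close>. If
both ends of an edge had the same color, then \<open>c1\<close> would agree on an edge inside \<open>Z\<close> or \<open>c0\<close> on an
edge outside \<open>W\<close>. A \<open>k\<close>-coloring can be made Borel on any region whose connected pieces are bounded
(\<open>fibrewise_coloring\<close>), so everything rests on walls \<open>W\<close> for which the pieces of the complement of \<open>W\<close>
and the pieces of \<open>Z\<close> are bounded, though not uniformly over the space.

Such walls come from covers at all scales. At every scale the space is covered by \<open>C\<close> Borel sets,
each of which falls into pieces that are bounded and far apart in terms of the scale, where \<open>C\<close> does
not depend on the scale (\<open>scale_data_exists\<close>). By the pigeonhole principle every point lies in sets
of one index \<open>j\<close> at infinitely many scales, and since the sets grow with the scale when they are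
thickened, the same \<open>j\<close> serves the whole connected component. Let the scales grow fast and process
the sets of index \<open>j\<close> one scale after the other, each new piece swallowing whole earlier
pieces, which are represented by their markers. Every point is eventually deep inside a piece, and
the shells just inside the boundaries of the pieces, with the parts that lie in earlier pieces left
out, are the walls (\<open>toast_coloring\<close>).

The covers exist because of commutativity. A ball of \<open>X\<close> may be exponentially large, as points have
many preimages. But if \<open>T a x = T b y\<close> and \<open>e\<close> dominates \<open>b\<close>, then \<open>T e y = T (e - b + a) x\<close>: a
large power of the maps sends everything near \<open>x\<close> into the forward orbit of \<open>x\<close>, which is the image
of a box of exponents. Markers are chosen among such shifted points, so the number of markers close
to a point is bounded as in a box of \<open>card I\<close> dimensions. Moreover, all decisions about \<open>x\<close> only refer to its
forward orbit and hence are Borel.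

Only two steps look at preimages, namely the Borel coloring of a graph of bounded degree with
finitely many colors (\<open>finite_borel_coloring\<close>) and the \<open>k\<close>-coloring of bounded pieces. In both, each
point picks one of countably many options, the points for which an option is admissible form a
coanalytic set, and the separation theorem of Novikov makes the choice Borel
(\<open>coanalytic_selection\<close>).

For a free action of \<open>\<nat>\<close>-tuples, the parity of the total length of the two tuples that join a point to
a chosen point of its component is a proper \<open>2\<close>-coloring.\<close>

section \<open>Analytic sets and selection from coanalytic sets\<close>

text \<open>For Hausdorff \<open>T\<close>, a tree presentation is the graph of a continuous map into \<open>T\<close> whose domain is a
closed set of sequences: if every finite part of \<open>\<sigma>\<close> extends to an element of the domain, then \<open>\<sigma>\<close> is in the domain
and the values at all sequences close to \<open>\<sigma>\<close> converge to the value at \<open>\<sigma>\<close>. Keeping the graph, and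
not the map, makes unions, intersections and projections a matter of recoding sequences.\<close>

definition tree_presentation :: "'z topology \<Rightarrow> ((nat \<Rightarrow> nat) \<times> 'z) set \<Rightarrow> bool" where
  "tree_presentation T \<Gamma> \<longleftrightarrow> snd ` \<Gamma> \<subseteq> topspace T \<and>
     (\<forall>\<sigma>. (\<forall>n. \<exists>\<tau> x. (\<tau>, x) \<in> \<Gamma> \<and> (\<forall>i<n. \<tau> i = \<sigma> i)) \<longrightarrow>
        (\<exists>x. (\<sigma>, x) \<in> \<Gamma> \<and>
           (\<forall>W. openin T W \<and> x \<in> W \<longrightarrow>
              (\<exists>n. \<forall>\<tau> y. (\<tau>, y) \<in> \<Gamma> \<and> (\<forall>i<n. \<tau> i = \<sigma> i) \<longrightarrow> y \<in> W))))"

definition analytic_in :: "'z topology \<Rightarrow> 'z set \<Rightarrow> bool" where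
  "analytic_in T A \<longleftrightarrow> (\<exists>\<Gamma>. tree_presentation T \<Gamma> \<and> A = snd ` \<Gamma>)"

lemma tree_presentation_topspace:
  "tree_presentation T \<Gamma> \<Longrightarrow> (\<sigma>, x) \<in> \<Gamma> \<Longrightarrow> x \<in> topspace T"
  unfolding tree_presentation_def by force

lemma tree_presentation_limit:
  assumes "tree_presentation T \<Gamma>" "\<And>n. \<exists>\<tau> x. (\<tau>, x) \<in> \<Gamma> \<and> (\<forall>i<n. \<tau> i = \<sigma> i)"
  shows "\<exists>x. (\<sigma>, x) \<in> \<Gamma> \<and> (\<forall>W. openin T W \<and> x \<in> W \<longrightarrow>
           (\<exists>n. \<forall>\<tau> y. (\<tau>, y) \<in> \<Gamma> \<and> (\<forall>i<n. \<tau> i = \<sigma> i) \<longrightarrow> y \<in> W))"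
  using assms(1)[unfolded tree_presentation_def, THEN conjunct2, rule_format, of \<sigma>] assms(2) by blast

lemma analytic_in_empty: "analytic_in T {}"
  unfolding analytic_in_def tree_presentation_def by (intro exI[of _ "{}"]) auto

text \<open>The first entry of a sequence chooses the set, the remaining entries follow its presentation.\<close>

lemma analytic_in_UN:
  assumes "\<And>k::nat. analytic_in T (A k)"
  shows "analytic_in T (\<Union>k. A k)"
proof -
  from assms obtain G where G: "\<And>k. tree_presentation T (G k)" "\<And>k. A k = snd ` G k"
    unfolding analytic_in_def by metis
  define \<Gamma> where "\<Gamma> = {(\<sigma>, x). (\<lambda>i. \<sigma> (Suc i), x) \<in> G (\<sigma> 0)}"
  have "tree_presentation T \<Gamma>"
    unfolding tree_presentation_def
  proof (intro conjI allI impI)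
    show "snd ` \<Gamma> \<subseteq> topspace T"
      using tree_presentation_topspace[OF G(1)] by (auto simp: \<Gamma>_def)
    fix \<sigma> assume *: "\<forall>n. \<exists>\<tau> x. (\<tau>, x) \<in> \<Gamma> \<and> (\<forall>i<n. \<tau> i = \<sigma> i)"
    have "\<exists>\<tau> x. (\<tau>, x) \<in> G (\<sigma> 0) \<and> (\<forall>i<n. \<tau> i = \<sigma> (Suc i))" for n
    proof -
      from * obtain \<tau> x where "(\<tau>, x) \<in> \<Gamma>" "\<forall>i<Suc n. \<tau> i = \<sigma> i" by blast
      then show ?thesis by (intro exI[of _ "\<lambda>i. \<tau> (Suc i)"] exI[of _ x]) (auto simp: \<Gamma>_def)
    qed
    from tree_presentation_limit[OF G(1) this]
    obtain x where x: "(\<lambda>i. \<sigma> (Suc i), x) \<in> G (\<sigma> 0)"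
      "\<forall>W. openin T W \<and> x \<in> W \<longrightarrow>
        (\<exists>n. \<forall>\<tau> y. (\<tau>, y) \<in> G (\<sigma> 0) \<and> (\<forall>i<n. \<tau> i = \<sigma> (Suc i)) \<longrightarrow> y \<in> W)"
      by (elim exE conjE)
    show "\<exists>x. (\<sigma>, x) \<in> \<Gamma> \<and> (\<forall>W. openin T W \<and> x \<in> W \<longrightarrow>
              (\<exists>n. \<forall>\<tau> y. (\<tau>, y) \<in> \<Gamma> \<and> (\<forall>i<n. \<tau> i = \<sigma> i) \<longrightarrow> y \<in> W))"
    proof (intro exI[of _ x] conjI allI impI)
      show "(\<sigma>, x) \<in> \<Gamma>" using x(1) by (simp add: \<Gamma>_def)
      fix W assume "openin T W \<and> x \<in> W"
      from x(2)[rule_format, OF this]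
      obtain n where n: "\<And>\<tau> y. (\<tau>, y) \<in> G (\<sigma> 0) \<Longrightarrow> (\<forall>i<n. \<tau> i = \<sigma> (Suc i)) \<Longrightarrow> y \<in> W"
        by (elim exE) auto
      show "\<exists>n. \<forall>\<tau> y. (\<tau>, y) \<in> \<Gamma> \<and> (\<forall>i<n. \<tau> i = \<sigma> i) \<longrightarrow> y \<in> W"
      proof (intro exI[of _ "Suc n"] allI impI)
        fix \<tau> y assume a: "(\<tau>, y) \<in> \<Gamma> \<and> (\<forall>i<Suc n. \<tau> i = \<sigma> i)"
        then have "(\<lambda>i. \<tau> (Suc i), y) \<in> G (\<sigma> 0)" by (auto simp: \<Gamma>_def)
        then show "y \<in> W" by (rule n) (use a in auto)
      qed
    qed
  qed
  moreover have "(\<Union>k. A k) = snd ` \<Gamma>"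
  proof safe
    fix x k assume "x \<in> A k"
    then obtain \<tau> where "(\<tau>, x) \<in> G k" using G(2) by auto
    then have "(\<lambda>i. case i of 0 \<Rightarrow> k | Suc j \<Rightarrow> \<tau> j, x) \<in> \<Gamma>" by (simp add: \<Gamma>_def)
    then show "x \<in> snd ` \<Gamma>" by force
  next
    fix \<sigma> x assume "(\<sigma>, x) \<in> \<Gamma>"
    then show "snd (\<sigma>, x) \<in> (\<Union>k. A k)" using G(2) by (force simp: \<Gamma>_def)
  qed
  ultimately show ?thesis unfolding analytic_in_def by blast
qed

text \<open>One sequence codes countably many via a pairing function. The rows of a limit sequence have limit
points of their own, and these coincide because points of the presentation lie close to all of them.\<close>

lemma analytic_in_INT:
  assumes H: "Hausdorff_space T" and "\<And>k::nat. analytic_in T (A k)"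
  shows "analytic_in T (\<Inter>k. A k)"
proof -
  from assms(2) obtain G where G: "\<And>k. tree_presentation T (G k)" "\<And>k. A k = snd ` G k"
    unfolding analytic_in_def by metis
  define row where "row = (\<lambda>(\<sigma>::nat \<Rightarrow> nat) k j. \<sigma> (prod_encode (k, j)))"
  define \<Gamma> where "\<Gamma> = {(\<sigma>, x). \<forall>k. (row \<sigma> k, x) \<in> G k}"
  have row_agree: "\<exists>m. \<forall>\<tau>. (\<forall>i<m. \<tau> i = \<sigma> i) \<longrightarrow> (\<forall>i<n. row \<tau> k i = row \<sigma> k i)" for \<sigma> n k
  proof (intro exI[of _ "Suc (Max ((\<lambda>j. prod_encode (k, j)) ` {..n}))"] allI impI)
    fix \<tau> i assume *: "\<forall>i<Suc (Max ((\<lambda>j. prod_encode (k, j)) ` {..n})). \<tau> i = \<sigma> i" and "i < n"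
    then have "prod_encode (k, i) \<le> Max ((\<lambda>j. prod_encode (k, j)) ` {..n})" by (intro Max_ge) auto
    with * show "row \<tau> k i = row \<sigma> k i" by (auto simp: row_def)
  qed
  have "tree_presentation T \<Gamma>"
    unfolding tree_presentation_def
  proof (intro conjI allI impI)
    show "snd ` \<Gamma> \<subseteq> topspace T"
      using tree_presentation_topspace[OF G(1)] unfolding \<Gamma>_def by auto blast
    fix \<sigma> assume *: "\<forall>n. \<exists>\<tau> x. (\<tau>, x) \<in> \<Gamma> \<and> (\<forall>i<n. \<tau> i = \<sigma> i)"
    have ex: "\<exists>\<tau> x. (\<tau>, x) \<in> G k \<and> (\<forall>i<n. \<tau> i = row \<sigma> k i)" for n k
    proof -
      obtain m where m: "\<forall>\<tau>. (\<forall>i<m. \<tau> i = \<sigma> i) \<longrightarrow> (\<forall>i<n. row \<tau> k i = row \<sigma> k i)"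
        using row_agree[of \<sigma> n k] by (elim exE)
      obtain \<tau> x where \<tau>: "(\<tau>, x) \<in> \<Gamma>" "\<forall>i<m. \<tau> i = \<sigma> i"
        using *[rule_format, of m] by (elim exE conjE)
      then have "(row \<tau> k, x) \<in> G k" by (simp add: \<Gamma>_def)
      moreover have "\<forall>i<n. row \<tau> k i = row \<sigma> k i" using m[THEN spec, THEN mp, OF \<tau>(2)] .
      ultimately show ?thesis by (intro exI conjI)
    qed
    have "\<forall>k. \<exists>x. (row \<sigma> k, x) \<in> G k \<and> (\<forall>W. openin T W \<and> x \<in> W \<longrightarrow>
            (\<exists>n. \<forall>\<tau> y. (\<tau>, y) \<in> G k \<and> (\<forall>i<n. \<tau> i = row \<sigma> k i) \<longrightarrow> y \<in> W))"
      by (intro allI tree_presentation_limit[OF G(1) ex])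
    then obtain x where x: "\<forall>k. (row \<sigma> k, x k) \<in> G k \<and> (\<forall>W. openin T W \<and> x k \<in> W \<longrightarrow>
            (\<exists>n. \<forall>\<tau> y. (\<tau>, y) \<in> G k \<and> (\<forall>i<n. \<tau> i = row \<sigma> k i) \<longrightarrow> y \<in> W))"
      by (rule choice[THEN exE])
    have x1: "(row \<sigma> k, x k) \<in> G k" and xT: "x k \<in> topspace T" for k
      using x tree_presentation_topspace[OF G(1)] by blast+
    have near: "\<exists>m. \<forall>\<tau> y. (\<tau>, y) \<in> \<Gamma> \<and> (\<forall>i<m. \<tau> i = \<sigma> i) \<longrightarrow> y \<in> W" if W: "openin T W" "x k \<in> W" for W k
    proof -
      obtain n where n: "\<forall>\<tau> y. (\<tau>, y) \<in> G k \<and> (\<forall>i<n. \<tau> i = row \<sigma> k i) \<longrightarrow> y \<in> W"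
        using x[rule_format, THEN conjunct2, rule_format, OF conjI[OF W]] by (elim exE)
      obtain m where m: "\<forall>\<tau>. (\<forall>i<m. \<tau> i = \<sigma> i) \<longrightarrow> (\<forall>i<n. row \<tau> k i = row \<sigma> k i)"
        using row_agree[of \<sigma> n k] by (elim exE)
      show ?thesis
      proof (intro exI[of _ m] allI impI, elim conjE)
        fix \<tau> y assume "(\<tau>, y) \<in> \<Gamma>" "\<forall>i<m. \<tau> i = \<sigma> i"
        then have "(row \<tau> k, y) \<in> G k \<and> (\<forall>i<n. row \<tau> k i = row \<sigma> k i)"
          using m[THEN spec, THEN mp] by (intro conjI) (simp add: \<Gamma>_def)
        then show "y \<in> W" by (rule n[THEN spec, THEN spec, THEN mp])
      qed
    qed
    have same: "x k = x 0" for k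
    proof (rule ccontr)
      assume "x k \<noteq> x 0"
      then obtain U V where UV: "openin T U" "openin T V" "x k \<in> U" "x 0 \<in> V" "disjnt U V"
        using H xT unfolding Hausdorff_space_def by metis
      obtain m where m: "\<forall>\<tau> y. (\<tau>, y) \<in> \<Gamma> \<and> (\<forall>i<m. \<tau> i = \<sigma> i) \<longrightarrow> y \<in> U"
        using near[OF UV(1,3)] by blast
      obtain m' where m': "\<forall>\<tau> y. (\<tau>, y) \<in> \<Gamma> \<and> (\<forall>i<m'. \<tau> i = \<sigma> i) \<longrightarrow> y \<in> V"
        using near[OF UV(2,4)] by blast
      obtain \<tau> y where "(\<tau>, y) \<in> \<Gamma>" "\<forall>i<max m m'. \<tau> i = \<sigma> i"
        using *[rule_format, of "max m m'"] by (elim exE conjE)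
      then have "y \<in> U" "y \<in> V" using m[rule_format, of \<tau> y] m'[rule_format, of \<tau> y] by auto
      then show False using UV(5) by (auto simp: disjnt_iff)
    qed
    show "\<exists>x. (\<sigma>, x) \<in> \<Gamma> \<and> (\<forall>W. openin T W \<and> x \<in> W \<longrightarrow>
              (\<exists>n. \<forall>\<tau> y. (\<tau>, y) \<in> \<Gamma> \<and> (\<forall>i<n. \<tau> i = \<sigma> i) \<longrightarrow> y \<in> W))"
    proof (intro exI[of _ "x 0"] conjI)
      have "(row \<sigma> k, x 0) \<in> G k" for k using x1[of k] same[of k] by simp
      then show "(\<sigma>, x 0) \<in> \<Gamma>" by (simp add: \<Gamma>_def)
    qed (use near in blast)
  qed
  moreover have "(\<Inter>k. A k) = snd ` \<Gamma>"
  proof safe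
    fix x assume x: "x \<in> (\<Inter>k. A k)"
    have "\<forall>k. \<exists>\<tau>. (\<tau>, x) \<in> G k" using x G(2) by force
    then obtain t where t: "\<forall>k. (t k, x) \<in> G k" by (rule choice[THEN exE])
    have "(\<lambda>i. case prod_decode i of (k, j) \<Rightarrow> t k j, x) \<in> \<Gamma>"
      using t by (simp add: \<Gamma>_def row_def)
    then show "x \<in> snd ` \<Gamma>" by force
  next
    fix \<sigma> x k assume "(\<sigma>, x) \<in> \<Gamma>"
    then show "snd (\<sigma>, x) \<in> A k" using G(2) by (force simp: \<Gamma>_def)
  qed
  ultimately show ?thesis unfolding analytic_in_def by blast
qed

text \<open>A sequence of indices into a countable dense set \<open>q\<close> presents the point to which the balls of radius
\<open>(1/2)^n\<close> around the indexed elements shrink; completeness makes the set of such sequences closed.\<close>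

lemma closedin_imp_analytic_in:
  assumes T: "completely_metrizable_space T" "second_countable T" and C: "closedin T C"
  shows "analytic_in T C"
proof (cases "C = {}")
  case True then show ?thesis by (simp add: analytic_in_empty)
next
  case False
  obtain M d where Md: "Metric_space M d" "Metric_space.mcomplete M d" "T = Metric_space.mtopology M d"
    using T(1) unfolding completely_metrizable_space_def by auto
  interpret Metric_space M d by fact
  have top: "topspace T = M" by (simp add: Md(3))
  obtain Q where Q: "countable Q" "Q \<subseteq> M" "T closure_of Q = M"
    using second_countable_imp_separable_space[OF T(2)] top unfolding separable_space_def by auto
  have CM: "C \<subseteq> M" using closedin_subset[OF C] top by simp
  have "Q \<noteq> {}" using Q(3) False CM by auto
  then obtain q :: "nat \<Rightarrow> _" where q: "Q = range q" using Q(1) range_from_nat_into[of Q] by metis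
  have qM: "q n \<in> M" for n using q Q(2) by auto
  have dense: "\<exists>n. d x (q n) \<le> e" if xM: "x \<in> M" and e: "e > 0" for x e
  proof -
    have "x \<in> mtopology closure_of Q" using xM Q(3) Md(3) by simp
    then obtain y where "y \<in> Q" "y \<in> mball x e"
      unfolding metric_closure_of using e by auto
    then show ?thesis using q by (auto simp: in_mball intro: less_imp_le)
  qed
  define \<Gamma> where "\<Gamma> = {(\<sigma>, x). x \<in> C \<and> (\<forall>n. d x (q (\<sigma> n)) \<le> (1/2)^n)}"
  have "tree_presentation T \<Gamma>"
    unfolding tree_presentation_def
  proof (intro conjI allI impI)
    show "snd ` \<Gamma> \<subseteq> topspace T" using CM top by (auto simp: \<Gamma>_def)
    fix \<sigma> assume *: "\<forall>n. \<exists>\<tau> x. (\<tau>, x) \<in> \<Gamma> \<and> (\<forall>i<n. \<tau> i = \<sigma> i)"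
    then obtain t x where tx: "\<And>n. (t n, x n) \<in> \<Gamma>" "\<And>n i. i < n \<Longrightarrow> t n i = \<sigma> i" by metis
    have xC: "x n \<in> C" and xM: "x n \<in> M" for n using tx(1)[of n] CM by (auto simp: \<Gamma>_def)
    have dq: "d (x n) (q (\<sigma> i)) \<le> (1/2)^i" if "i < n" for n i
    proof -
      have "d (x n) (q (t n i)) \<le> (1/2)^i" using tx(1)[of n] unfolding \<Gamma>_def by blast
      then show ?thesis using tx(2)[OF that] by simp
    qed
    have "MCauchy x"
      unfolding MCauchy_def
    proof (intro conjI allI impI)
      show "range x \<subseteq> M" using xM by auto
      fix e :: real assume "e > 0"
      then obtain i where i: "(1/2::real)^i < e/2"
        using real_arch_pow_inv[of "e/2" "1/2"] by auto
      have "d (x n) (x n') < e" if "Suc i \<le> n" "Suc i \<le> n'" for n n'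
      proof -
        have "d (x n) (x n') \<le> d (x n) (q (\<sigma> i)) + d (q (\<sigma> i)) (x n')"
          using triangle xM qM by blast
        also have "\<dots> \<le> (1/2)^i + (1/2)^i"
          using dq[of i n] dq[of i n'] that commute[of "q (\<sigma> i)" "x n'"] by auto
        finally show ?thesis using i by linarith
      qed
      then show "\<exists>N. \<forall>n n'. N \<le> n \<longrightarrow> N \<le> n' \<longrightarrow> d (x n) (x n') < e" by blast
    qed
    then obtain l where l: "limitin mtopology x l sequentially"
      using Md(2) unfolding mcomplete_def by auto
    have lC: "l \<in> C"
      using C l xC metric_closedin_iff_sequentially_closed[of C] unfolding Md(3) by blast
    then have lM: "l \<in> M" using CM by auto
    have dl: "d l (q (\<sigma> i)) \<le> (1/2)^i" for i
    proof (rule field_le_epsilon)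
      fix e :: real assume "e > 0"
      then obtain N where N: "\<And>n. n \<ge> N \<Longrightarrow> d (x n) l < e"
        using l unfolding limit_metric_sequentially by blast
      define n where "n = max N (Suc i)"
      have "d l (q (\<sigma> i)) \<le> d l (x n) + d (x n) (q (\<sigma> i))" using triangle lM xM qM by blast
      also have "\<dots> \<le> e + (1/2)^i"
        using N[of n] dq[of i n] commute[of l "x n"] unfolding n_def
        by (metis add_mono less_imp_le lessI max.cobounded1 max.cobounded2 order_less_le_trans)
      finally show "d l (q (\<sigma> i)) \<le> (1/2)^i + e" by simp
    qed
    show "\<exists>x. (\<sigma>, x) \<in> \<Gamma> \<and> (\<forall>W. openin T W \<and> x \<in> W \<longrightarrow>
              (\<exists>n. \<forall>\<tau> y. (\<tau>, y) \<in> \<Gamma> \<and> (\<forall>i<n. \<tau> i = \<sigma> i) \<longrightarrow> y \<in> W))"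
    proof (intro exI[of _ l] conjI allI impI)
      show "(\<sigma>, l) \<in> \<Gamma>" using lC dl by (auto simp: \<Gamma>_def)
      fix W assume W: "openin T W \<and> l \<in> W"
      then obtain e where e: "e > 0" "mball l e \<subseteq> W" unfolding Md(3) openin_mtopology by blast
      obtain i where i: "(1/2::real)^i < e/2"
        using real_arch_pow_inv[of "e/2" "1/2"] e(1) by auto
      show "\<exists>n. \<forall>\<tau> y. (\<tau>, y) \<in> \<Gamma> \<and> (\<forall>i<n. \<tau> i = \<sigma> i) \<longrightarrow> y \<in> W"
      proof (intro exI[of _ "Suc i"] allI impI)
        fix \<tau> y assume y: "(\<tau>, y) \<in> \<Gamma> \<and> (\<forall>j<Suc i. \<tau> j = \<sigma> j)"
        have yM: "y \<in> M" using y CM unfolding \<Gamma>_def by blast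
        have "d y (q (\<tau> i)) \<le> (1/2)^i" using y unfolding \<Gamma>_def by blast
        moreover have "\<tau> i = \<sigma> i" using y by simp
        ultimately have dy: "d y (q (\<sigma> i)) \<le> (1/2)^i" by simp
        have "d l y \<le> d l (q (\<sigma> i)) + d (q (\<sigma> i)) y" using triangle lM yM qM by blast
        also have "\<dots> < e" using dl[of i] dy commute[of y "q (\<sigma> i)"] i by linarith
        finally show "y \<in> W" using e(2) lM yM by (auto simp: in_mball)
      qed
    qed
  qed
  moreover have "C = snd ` \<Gamma>"
  proof safe
    fix x assume x: "x \<in> C"
    have "\<forall>n. \<exists>m. d x (q m) \<le> (1/2)^n" using dense x CM by auto
    then obtain \<sigma> where "\<forall>n. d x (q (\<sigma> n)) \<le> (1/2)^n" by metis
    then have "(\<sigma>, x) \<in> \<Gamma>" using x by (simp add: \<Gamma>_def)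
    then show "x \<in> snd ` \<Gamma>" by force
  qed (auto simp: \<Gamma>_def)
  ultimately show ?thesis unfolding analytic_in_def by blast
qed

text \<open>The sets that are analytic together with their complements form a \<open>\<sigma>\<close>-algebra, and it contains the
open sets since these are countable unions of closed sets.\<close>

lemma borel_imp_analytic_in:
  assumes T: "completely_metrizable_space T" "second_countable T"
    and A: "A \<in> sigma_sets (topspace T) {U. openin T U}"
  shows "analytic_in T A"
proof -
  have met: "metrizable_space T" using T(1) by (rule completely_metrizable_imp_metrizable_space)
  have H: "Hausdorff_space T" using met by (rule metrizable_imp_Hausdorff_space)
  have "analytic_in T A \<and> analytic_in T (topspace T - A)"
    using A
  proof (induction rule: sigma_sets.induct)
    case (Basic U)
    then have U: "openin T U" by simp
    have "fsigma_in T U" using open_imp_fsigma_in[OF met U] .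
    then obtain C :: "nat \<Rightarrow> _" where C: "\<And>n. closedin T (C n)" "(\<Union>n. C n) = U"
      unfolding fsigma_in_ascending by blast
    have "analytic_in T (\<Union>n. C n)"
      by (intro analytic_in_UN closedin_imp_analytic_in[OF T] C)
    then show ?case using C(2) U closedin_imp_analytic_in[OF T] by auto
  next
    case Empty
    then show ?case using analytic_in_empty closedin_imp_analytic_in[OF T closedin_topspace] by auto
  next
    case (Compl a)
    have "{U. openin T U} \<subseteq> Pow (topspace T)" using openin_subset by auto
    then have "a \<subseteq> topspace T" using Compl.hyps by (rule sigma_sets_into_sp)
    then have "topspace T - (topspace T - a) = a" by auto
    with Compl show ?case by auto
  next
    case (Union a)
    have eq: "topspace T - (\<Union>i. a i) = (\<Inter>i. topspace T - a i)" by auto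
    show ?case
      using Union analytic_in_UN[of T a] analytic_in_INT[OF H, of "\<lambda>i. topspace T - a i"]
      unfolding eq by blast
  qed
  then show ?thesis by simp
qed

lemma analytic_in_projection:
  assumes "analytic_in (prod_topology T T') R"
  shows "analytic_in T (fst ` R)"
proof -
  obtain G where G: "tree_presentation (prod_topology T T') G" "R = snd ` G"
    using assms unfolding analytic_in_def by auto
  define \<Gamma> where "\<Gamma> = {(\<sigma>, x). \<exists>y. (\<sigma>, (x, y)) \<in> G}"
  have "tree_presentation T \<Gamma>"
    unfolding tree_presentation_def
  proof (intro conjI allI impI)
    show "snd ` \<Gamma> \<subseteq> topspace T"
      using tree_presentation_topspace[OF G(1)] by (fastforce simp: \<Gamma>_def)
    fix \<sigma> assume "\<forall>n. \<exists>\<tau> x. (\<tau>, x) \<in> \<Gamma> \<and> (\<forall>i<n. \<tau> i = \<sigma> i)"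
    then have "\<exists>\<tau> z. (\<tau>, z) \<in> G \<and> (\<forall>i<n. \<tau> i = \<sigma> i)" for n by (fastforce simp: \<Gamma>_def)
    then obtain z where z: "(\<sigma>, z) \<in> G"
      "\<forall>W. openin (prod_topology T T') W \<and> z \<in> W \<longrightarrow>
          (\<exists>n. \<forall>\<tau> y. (\<tau>, y) \<in> G \<and> (\<forall>i<n. \<tau> i = \<sigma> i) \<longrightarrow> y \<in> W)"
      using tree_presentation_limit[OF G(1), of \<sigma>] by blast
    have zT: "z \<in> topspace (prod_topology T T')" using tree_presentation_topspace[OF G(1) z(1)] .
    show "\<exists>x. (\<sigma>, x) \<in> \<Gamma> \<and> (\<forall>W. openin T W \<and> x \<in> W \<longrightarrow>
              (\<exists>n. \<forall>\<tau> y. (\<tau>, y) \<in> \<Gamma> \<and> (\<forall>i<n. \<tau> i = \<sigma> i) \<longrightarrow> y \<in> W))"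
    proof (intro exI[of _ "fst z"] conjI allI impI)
      show "(\<sigma>, fst z) \<in> \<Gamma>" using z(1) by (auto simp: \<Gamma>_def intro: exI[of _ "snd z"])
      fix W assume W: "openin T W \<and> fst z \<in> W"
      then have "openin (prod_topology T T') (W \<times> topspace T')" by (simp add: openin_prod_Times_iff)
      moreover have "z \<in> W \<times> topspace T'" using W zT by auto
      ultimately obtain n where
        n: "\<forall>\<tau> y. (\<tau>, y) \<in> G \<and> (\<forall>i<n. \<tau> i = \<sigma> i) \<longrightarrow> y \<in> W \<times> topspace T'" using z(2) by blast
      then show "\<exists>n. \<forall>\<tau> y. (\<tau>, y) \<in> \<Gamma> \<and> (\<forall>i<n. \<tau> i = \<sigma> i) \<longrightarrow> y \<in> W"
        by (intro exI[of _ n]) (auto simp: \<Gamma>_def)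
    qed
  qed
  moreover have "fst ` R = snd ` \<Gamma>" unfolding G(2) \<Gamma>_def by force
  ultimately show ?thesis unfolding analytic_in_def by blast
qed

text \<open>Call a sequence of sets separated if it has Borel supersets with empty intersection. If one member
is a countable union and every choice of a piece yields a separated sequence, then the original
sequence is separated. So a sequence that is not separated can be refined forever, the steps being
distributed over all members, and each member shrinks to a point of the corresponding \<open>A n\<close>. As the
\<open>A n\<close> have no common point, two of these limit points differ, and disjoint neighbourhoods of them
separate the sequence after finitely many steps.\<close>

lemma Novikov_separation:
  fixes A :: "nat \<Rightarrow> 'z set"
  assumes H: "Hausdorff_space T" and A: "\<And>n. analytic_in T (A n)" and disj: "(\<Inter>n. A n) = {}"
    and X: "space X = topspace T" "sets X = sigma_sets (topspace T) {U. openin T U}"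
  shows "\<exists>B. (\<forall>n. B n \<in> sets X \<and> A n \<subseteq> B n) \<and> (\<Inter>n. B n) = {}"
proof -
  define sep where "sep = (\<lambda>P::nat \<Rightarrow> 'z set. \<exists>B. (\<forall>n. B n \<in> sets X \<and> P n \<subseteq> B n) \<and> (\<Inter>n. B n) = {})"
  have split: "sep P" if P: "P k = (\<Union>v::nat. Q v)" and Q: "\<And>v. sep (P(k := Q v))" for P k Q
  proof -
    from Q obtain B where B: "\<And>v n. B v n \<in> sets X" "\<And>v n. (P(k := Q v)) n \<subseteq> B v n"
      "\<And>v. (\<Inter>n. B v n) = {}"
      unfolding sep_def by metis
    define B' where "B' = (\<lambda>n. if n = k then (\<Union>v. B v k) else (\<Inter>v. B v n))"
    have "B' n \<in> sets X" for n
      using B(1) unfolding B'_def by (auto intro!: sets.countable_INT'' sets.countable_UN)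
    moreover have "P n \<subseteq> B' n" for n
    proof (cases "n = k")
      case True
      have "Q v \<subseteq> B v k" for v using B(2)[of v k] by simp
      then show ?thesis using True P by (auto simp: B'_def)
    next
      case False
      have "P n \<subseteq> B v n" for v using B(2)[of v n] False by simp
      then show ?thesis using False by (auto simp: B'_def)
    qed
    moreover have "(\<Inter>n. B' n) = {}"
    proof (rule ccontr)
      assume "(\<Inter>n. B' n) \<noteq> {}"
      then obtain x where x: "\<And>n. x \<in> B' n" by auto
      then obtain v where v: "x \<in> B v k" using x[of k] by (auto simp: B'_def)
      have "x \<in> B v n" for n using x[of n] v by (cases "n = k") (auto simp: B'_def)
      then show False using B(3)[of v] by auto
    qed
    ultimately show ?thesis unfolding sep_def by blast
  qed
  from A obtain G where G: "\<And>k. tree_presentation T (G k)" "\<And>k. A k = snd ` G k"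
    unfolding analytic_in_def by metis
  (* After m steps the k-th set is cut down to the points presented by sequences which agree with
     row k of the branch at the positions handled so far; step m handles one position of one row. *)
  define fam where "fam = (\<lambda>m (\<sigma>::nat \<Rightarrow> nat) k. {x. \<exists>\<tau>. (\<tau>, x) \<in> G k \<and>
     (\<forall>j. prod_encode (k, j) < m \<longrightarrow> \<tau> j = \<sigma> (prod_encode (k, j)))})"
  have fam_cong: "fam m \<sigma> = fam m \<sigma>'" if "\<And>i. i < m \<Longrightarrow> \<sigma> i = \<sigma>' i" for m \<sigma> \<sigma>'
    unfolding fam_def using that by (intro ext Collect_cong ex_cong) auto
  have "sep A"
  proof (rule ccontr)
    assume nsep: "\<not> sep A"
    have fam0: "fam 0 \<sigma> = A" for \<sigma> unfolding fam_def G(2) by force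
    have step: "\<exists>\<sigma>'. \<not> sep (fam (Suc m) \<sigma>') \<and> (\<forall>i<m. \<sigma>' i = \<sigma> i)" if ns: "\<not> sep (fam m \<sigma>)" for m \<sigma>
    proof -
      obtain k j where kj: "m = prod_encode (k, j)" by (metis prod_decode_inverse surj_pair)
      define Q where "Q = (\<lambda>v. fam (Suc m) (\<sigma>(m := v)) k)"
      have less: "prod_encode (k', j') < Suc m \<longleftrightarrow> prod_encode (k', j') < m \<or> (k' = k \<and> j' = j)" for k' j'
        by (auto simp: less_Suc_eq kj)
      have eq: "fam (Suc m) (\<sigma>(m := v)) = (fam m \<sigma>)(k := Q v)" for v
      proof
        fix k'
        show "fam (Suc m) (\<sigma>(m := v)) k' = ((fam m \<sigma>)(k := Q v)) k'"
        proof (cases "k' = k")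
          case False
          then show ?thesis unfolding fam_def less by (auto intro!: Collect_cong ex_cong)
        qed (simp add: Q_def)
      qed
      have "fam m \<sigma> k = (\<Union>v. Q v)"
      proof safe
        fix x assume "x \<in> fam m \<sigma> k"
        then obtain \<tau> where \<tau>: "(\<tau>, x) \<in> G k"
          "\<forall>i. prod_encode (k, i) < m \<longrightarrow> \<tau> i = \<sigma> (prod_encode (k, i))" unfolding fam_def by blast
        have "x \<in> Q (\<tau> j)" unfolding Q_def fam_def less
          using \<tau> by (auto intro!: exI[of _ \<tau>] simp: kj)
        then show "x \<in> (\<Union>v. Q v)" by blast
      next
        fix x v assume "x \<in> Q v"
        then obtain \<tau> where \<tau>: "(\<tau>, x) \<in> G k"
          "\<forall>i. prod_encode (k, i) < Suc m \<longrightarrow> \<tau> i = (\<sigma>(m := v)) (prod_encode (k, i))"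
          unfolding Q_def fam_def by blast
        then show "x \<in> fam m \<sigma> k" unfolding fam_def
          by (intro CollectI exI[of _ \<tau>] conjI) (auto simp: less_Suc_eq)
      qed
      then obtain v where "\<not> sep ((fam m \<sigma>)(k := Q v))" using split ns by metis
      then show ?thesis using eq by (intro exI[of _ "\<sigma>(m := v)"]) auto
    qed
    have "\<exists>s. \<forall>m. \<not> sep (fam m (s m)) \<and> (\<forall>i<m. s (Suc m) i = s m i)"
      by (rule dependent_nat_choice[of "\<lambda>m \<sigma>. \<not> sep (fam m \<sigma>)" "\<lambda>m \<sigma> \<sigma>'. \<forall>i<m. \<sigma>' i = \<sigma> i"])
        (use nsep fam0 step in auto)
    then obtain s where s: "\<And>m. \<not> sep (fam m (s m))" "\<And>m i. i < m \<Longrightarrow> s (Suc m) i = s m i" by blast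
    define \<sigma> where "\<sigma> = (\<lambda>i. s (Suc i) i)"
    have "s m i = \<sigma> i" if "i < m" for m i
      using that
    proof (induction m)
      case (Suc m)
      then show ?case using s(2)[of i m] by (cases "i = m") (auto simp: \<sigma>_def)
    qed simp
    then have nsep\<sigma>: "\<not> sep (fam m \<sigma>)" for m using fam_cong[of m "s m" \<sigma>] s(1)[of m] by simp
    have famA: "fam m \<sigma> k \<subseteq> A k" for m k unfolding fam_def G(2) by force
    have AX: "A k \<subseteq> space X" for k
      using tree_presentation_topspace[OF G(1)] unfolding X(1) G(2) by auto
    have ne: "fam m \<sigma> k \<noteq> {}" for m k
    proof
      assume "fam m \<sigma> k = {}"
      then have "sep (fam m \<sigma>)" unfolding sep_def
        using famA AX by (intro exI[of _ "\<lambda>n. if n = k then {} else space X"]) (auto, blast)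
      then show False using nsep\<sigma> by simp
    qed
    define row where "row = (\<lambda>k j. \<sigma> (prod_encode (k, j)))"
    have fam_row: "\<exists>m. \<forall>x\<in>fam m \<sigma> k. \<exists>\<tau>. (\<tau>, x) \<in> G k \<and> (\<forall>i<n. \<tau> i = row k i)" for n k
    proof (intro exI[of _ "Suc (Max ((\<lambda>j. prod_encode (k, j)) ` {..n}))"] ballI)
      fix x assume "x \<in> fam (Suc (Max ((\<lambda>j. prod_encode (k, j)) ` {..n}))) \<sigma> k"
      then obtain \<tau> where \<tau>: "(\<tau>, x) \<in> G k" "\<And>i. prod_encode (k, i) \<le> Max ((\<lambda>j. prod_encode (k, j)) ` {..n})
          \<Longrightarrow> \<tau> i = row k i" unfolding fam_def row_def by (auto simp: less_Suc_eq_le)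
      then show "\<exists>\<tau>. (\<tau>, x) \<in> G k \<and> (\<forall>i<n. \<tau> i = row k i)"
        by (intro exI[of _ \<tau>] conjI allI impI \<tau>(2) Max_ge) auto
    qed
    have ex: "\<exists>\<tau> x. (\<tau>, x) \<in> G k \<and> (\<forall>i<n. \<tau> i = row k i)" for n k
      using fam_row[of k n] ne by blast
    have "\<forall>k. \<exists>x. (row k, x) \<in> G k \<and> (\<forall>W. openin T W \<and> x \<in> W \<longrightarrow>
            (\<exists>n. \<forall>\<tau> y. (\<tau>, y) \<in> G k \<and> (\<forall>i<n. \<tau> i = row k i) \<longrightarrow> y \<in> W))"
      by (intro allI tree_presentation_limit[OF G(1) ex])
    then obtain x where x: "\<forall>k. (row k, x k) \<in> G k \<and> (\<forall>W. openin T W \<and> x k \<in> W \<longrightarrow>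
            (\<exists>n. \<forall>\<tau> y. (\<tau>, y) \<in> G k \<and> (\<forall>i<n. \<tau> i = row k i) \<longrightarrow> y \<in> W))"
      by (rule choice[THEN exE])
    have x1: "(row k, x k) \<in> G k" and xT: "x k \<in> topspace T" for k
      using x tree_presentation_topspace[OF G(1)] by blast+
    have mono: "fam m' \<sigma> k \<subseteq> fam m \<sigma> k" if "m \<le> m'" for m m' k
      unfolding fam_def using that by fastforce
    have inside: "\<exists>m. \<forall>m'\<ge>m. fam m' \<sigma> k \<subseteq> W" if W: "openin T W" "x k \<in> W" for W k
    proof -
      obtain n where n: "\<forall>\<tau> y. (\<tau>, y) \<in> G k \<and> (\<forall>i<n. \<tau> i = row k i) \<longrightarrow> y \<in> W"
        using x[rule_format, THEN conjunct2, rule_format, OF conjI[OF W]] by (elim exE)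
      obtain m where "\<forall>x\<in>fam m \<sigma> k. \<exists>\<tau>. (\<tau>, x) \<in> G k \<and> (\<forall>i<n. \<tau> i = row k i)"
        using fam_row by blast
      then have "fam m \<sigma> k \<subseteq> W" using n by blast
      then show ?thesis using mono by blast
    qed
    have xA: "x k \<in> A k" for k using x1[of k] G(2) by force
    obtain k where k: "x k \<noteq> x 0" using xA disj by (metis INT_I UNIV_I empty_iff)
    then obtain U V where UV: "openin T U" "openin T V" "x k \<in> U" "x 0 \<in> V" "disjnt U V"
      using H xT unfolding Hausdorff_space_def by metis
    obtain m where m: "\<forall>m'\<ge>m. fam m' \<sigma> k \<subseteq> U" using inside[OF UV(1,3)] by blast
    obtain m' where m': "\<forall>m''\<ge>m'. fam m'' \<sigma> 0 \<subseteq> V" using inside[OF UV(2,4)] by blast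
    have k0: "k \<noteq> 0" using k by (cases "k = 0") auto
    have open_sets: "W \<in> sets X" if "openin T W" for W using that X(2) by auto
    have "sep (fam (max m m') \<sigma>)"
      unfolding sep_def
    proof (intro exI[of _ "\<lambda>n. if n = k then U else if n = 0 then V else space X"] conjI allI)
      fix n
      show "(if n = k then U else if n = 0 then V else space X) \<in> sets X"
        using open_sets UV by auto
      show "fam (max m m') \<sigma> n \<subseteq> (if n = k then U else if n = 0 then V else space X)"
        using m m' famA AX by (auto, blast)
    next
      show "(\<Inter>n. if n = k then U else if n = 0 then V else space X) = {}"
      proof (rule ccontr)
        assume "\<not> ?thesis"
        then obtain z where z: "\<And>n. z \<in> (if n = k then U else if n = 0 then V else space X)" by blast
        have "z \<in> U" "z \<in> V" using z[of k] z[of 0] k0 by auto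
        then show False using UV(5) by (auto simp: disjnt_iff)
      qed
    qed
    then show False using nsep\<sigma> by simp
  qed
  then show ?thesis unfolding sep_def .
qed

lemma second_countable_prod_topology:
  assumes "second_countable S" "second_countable T"
  shows "second_countable (prod_topology S T)"
proof -
  obtain \<B> where \<B>: "countable \<B>" "\<forall>V\<in>\<B>. openin S V" "\<forall>U x. openin S U \<and> x \<in> U \<longrightarrow> (\<exists>V\<in>\<B>. x \<in> V \<and> V \<subseteq> U)"
    using assms(1) unfolding second_countable_def by metis
  obtain \<C> where \<C>: "countable \<C>" "\<forall>V\<in>\<C>. openin T V" "\<forall>U x. openin T U \<and> x \<in> U \<longrightarrow> (\<exists>V\<in>\<C>. x \<in> V \<and> V \<subseteq> U)"
    using assms(2) unfolding second_countable_def by metis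
  show ?thesis
    unfolding second_countable_def
  proof (intro exI[of _ "(\<lambda>(U, V). U \<times> V) ` (\<B> \<times> \<C>)"] conjI ballI allI impI)
    show "countable ((\<lambda>(U, V). U \<times> V) ` (\<B> \<times> \<C>))" using \<B>(1) \<C>(1) by auto
    show "openin (prod_topology S T) V" if "V \<in> (\<lambda>(U, V). U \<times> V) ` (\<B> \<times> \<C>)" for V
      using that \<B>(2) \<C>(2) by (auto simp: openin_prod_Times_iff)
    fix U x assume "openin (prod_topology S T) U \<and> x \<in> U"
    then obtain V W where "openin S V" "openin T W" "fst x \<in> V" "snd x \<in> W" "V \<times> W \<subseteq> U"
      unfolding openin_prod_topology_alt by (metis prod.collapse)
    moreover from this obtain V' W' where "V' \<in> \<B>" "W' \<in> \<C>" "fst x \<in> V'" "V' \<subseteq> V" "snd x \<in> W'" "W' \<subseteq> W"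
      using \<B>(3)[rule_format, of V "fst x"] \<C>(3)[rule_format, of W "snd x"] by blast
    ultimately show "\<exists>V\<in>(\<lambda>(U, V). U \<times> V) ` (\<B> \<times> \<C>). x \<in> V \<and> V \<subseteq> U"
      by (intro bexI[of _ "V' \<times> W'"]) (auto simp: mem_Times_iff)
  qed
qed

text \<open>Every point \<open>x\<close> has to choose an option \<open>n\<close> that no witness \<open>y\<close> forbids. The set of points for which
\<open>n\<close> is forbidden is analytic, being the projection of \<open>R n\<close>, and no point lies in all of these sets.
Borel supersets of them with empty intersection allow each point to take the first option whose
superset it avoids.\<close>

lemma coanalytic_selection:
  fixes X :: "'x measure"
  assumes "standard_borel X"
    and R: "\<And>n::nat. R n \<in> sets (X \<Otimes>\<^sub>M X)"
    and ex: "\<And>x. x \<in> space X \<Longrightarrow> \<exists>n. \<forall>y\<in>space X. (x, y) \<notin> R n"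
  obtains f where "f \<in> measurable X (count_space UNIV)"
    "\<And>x y. \<lbrakk>x \<in> space X; y \<in> space X\<rbrakk> \<Longrightarrow> (x, y) \<notin> R (f x)"
proof -
  obtain T where T: "completely_metrizable_space T" "second_countable T" "topspace T = space X"
    "sets X = sigma_sets (space X) {U. openin T U}"
    using assms(1) unfolding standard_borel_def by auto
  have H: "Hausdorff_space T"
    using T(1) by (simp add: completely_metrizable_imp_metrizable_space metrizable_imp_Hausdorff_space)
  let ?T2 = "prod_topology T T"
  define N where "N = sigma (space X \<times> space X) {U. openin ?T2 U}"
  have Pow2: "{U. openin ?T2 U} \<subseteq> Pow (space X \<times> space X)"
    using openin_subset[of ?T2] T(3) by auto
  have Nsets: "sets N = sigma_sets (space X \<times> space X) {U. openin ?T2 U}"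
    unfolding N_def using Pow2 by (simp add: sets_measure_of)
  have Nspace: "space N = space X \<times> space X" unfolding N_def using Pow2 by (simp add: space_measure_of)
  have proj: "h \<in> measurable N X" if h: "continuous_map ?T2 T h" for h
  proof (rule measurable_sigma_sets[OF T(4)])
    show "{U. openin T U} \<subseteq> Pow (space X)" using openin_subset T(3) by auto
    show "h \<in> space N \<rightarrow> space X" using h Nspace T(3) by (auto simp: continuous_map_def)
    fix U assume "U \<in> {U. openin T U}"
    then have "openin ?T2 {z \<in> topspace ?T2. h z \<in> U}" using h by (auto simp: continuous_map_def)
    moreover have "h -` U \<inter> space N = {z \<in> topspace ?T2. h z \<in> U}" using Nspace T(3) by auto
    ultimately show "h -` U \<inter> space N \<in> sets N" using Nsets by auto
  qed
  have "sets (X \<Otimes>\<^sub>M X) \<subseteq> sets N"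
    unfolding sets_pair_measure Nspace[symmetric]
  proof (rule sets.sigma_sets_subset, safe)
    fix a b assume ab: "a \<in> sets X" "b \<in> sets X"
    have "fst -` a \<inter> space N \<in> sets N" "snd -` b \<inter> space N \<in> sets N"
      using measurable_sets[OF proj[OF continuous_map_fst] ab(1)]
        measurable_sets[OF proj[OF continuous_map_snd] ab(2)] by auto
    then have "(fst -` a \<inter> space N) \<inter> (snd -` b \<inter> space N) \<in> sets N" by auto
    moreover have "(fst -` a \<inter> space N) \<inter> (snd -` b \<inter> space N) = a \<times> b"
      using sets.sets_into_space[OF ab(1)] sets.sets_into_space[OF ab(2)] Nspace by auto
    ultimately show "a \<times> b \<in> sets N" by simp
  qed
  then have RN: "R n \<in> sigma_sets (topspace ?T2) {U. openin ?T2 U}" for n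
    using R[of n] Nsets T(3) by auto
  have "completely_metrizable_space ?T2" "second_countable ?T2"
    using T by (auto simp: completely_metrizable_space_prod_topology second_countable_prod_topology)
  then have "analytic_in T (fst ` R n)" for n
    using analytic_in_projection borel_imp_analytic_in RN by blast
  moreover have "(\<Inter>n. fst ` R n) = {}"
  proof (rule ccontr)
    assume "(\<Inter>n. fst ` R n) \<noteq> {}"
    then obtain x where x: "\<And>n. x \<in> fst ` R n" by auto
    have Rsub: "R n \<subseteq> space X \<times> space X" for n
      using sets.sets_into_space[OF R[of n]] by (simp add: space_pair_measure)
    have "x \<in> space X" using x[of 0] Rsub[of 0] by auto
    then obtain n where n: "\<forall>y\<in>space X. (x, y) \<notin> R n" using ex by auto
    obtain z where "z \<in> R n" "x = fst z" using x[of n] by auto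
    then show False using n Rsub[of n] by (cases z) auto
  qed
  ultimately obtain B where B: "\<And>n. B n \<in> sets X" "\<And>n. fst ` R n \<subseteq> B n" "(\<Inter>n. B n) = {}"
    using Novikov_separation[OF H, of "\<lambda>n. fst ` R n" X] T(3,4) by metis
  define f where "f = (\<lambda>x. LEAST n. x \<notin> B n)"
  have f: "x \<notin> B (f x)" for x
    using B(3) LeastI_ex[of "\<lambda>n. x \<notin> B n"] unfolding f_def by auto
  show thesis
  proof
    have [measurable]: "Measurable.pred X (\<lambda>x. x \<in> B n)" for n using B(1) by simp
    show "f \<in> measurable X (count_space UNIV)" unfolding f_def by measurable
    show "(x, y) \<notin> R (f x)" if "x \<in> space X" "y \<in> space X" for x y
      using f[of x] B(2)[of "f x"] by force
  qed
qed

section \<open>Systems of commuting maps\<close>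

lemma standard_borel_separating_sequence:
  assumes "standard_borel X"
  obtains U :: "nat \<Rightarrow> 'x set" where "\<And>n. U n \<in> sets X"
    "\<And>x F. \<lbrakk>x \<in> space X; finite F; F \<subseteq> space X; x \<notin> F\<rbrakk> \<Longrightarrow> \<exists>n. x \<in> U n \<and> F \<inter> U n = {}"
proof -
  obtain T where T: "completely_metrizable_space T" "second_countable T" "topspace T = space X"
    "sets X = sigma_sets (space X) {U. openin T U}"
    using assms(1) unfolding standard_borel_def by auto
  have t1: "t1_space T"
    using T(1) by (simp add: completely_metrizable_imp_metrizable_space metrizable_imp_Hausdorff_space
        Hausdorff_imp_t1_space)
  obtain \<B> where \<B>: "countable \<B>" "\<forall>V\<in>\<B>. openin T V" "\<forall>U x. openin T U \<and> x \<in> U \<longrightarrow> (\<exists>V\<in>\<B>. x \<in> V \<and> V \<subseteq> U)"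
    using T(2) unfolding second_countable_def by metis
  define U where "U = from_nat_into (insert {} \<B>)"
  have rU: "range U = insert {} \<B>" unfolding U_def using \<B>(1) by (intro range_from_nat_into) auto
  show thesis
  proof
    fix n
    have "U n \<in> insert {} \<B>" using rU by auto
    then have "openin T (U n)" using \<B>(2) by auto
    then show "U n \<in> sets X" using T(4) by auto
  next
    fix x F assume F: "x \<in> space X" "finite F" "F \<subseteq> space X" "x \<notin> F"
    then have "closedin T F" using t1 T(3) unfolding t1_space_closedin_finite by auto
    then have "openin T (topspace T - F)" by auto
    then obtain V where V: "V \<in> \<B>" "x \<in> V" "V \<subseteq> topspace T - F" using \<B>(3) F T(3) by (metis DiffI)
    then obtain n where "V = U n" using rU by (metis insertCI rangeE)
    then show "\<exists>n. x \<in> U n \<and> F \<inter> U n = {}" using V by blast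
  qed
qed

lemma standard_borel_pred_eq:
  assumes "standard_borel X" and [measurable]: "f \<in> measurable N X" "g \<in> measurable N X"
  shows "Measurable.pred N (\<lambda>w. f w = g w)"
proof -
  obtain U where [measurable]: "\<And>n. U n \<in> sets X"
    and U: "\<And>x F. \<lbrakk>x \<in> space X; finite F; F \<subseteq> space X; x \<notin> F\<rbrakk> \<Longrightarrow> \<exists>n::nat. x \<in> U n \<and> F \<inter> U n = {}"
    using standard_borel_separating_sequence[OF assms(1)] by metis
  have "f w = g w \<longleftrightarrow> (\<forall>n. \<not> (f w \<in> U n \<and> g w \<notin> U n))" if w: "w \<in> space N" for w
  proof -
    have "f w \<in> space X" "g w \<in> space X" using w by (auto intro: measurable_space[OF assms(2)] measurable_space[OF assms(3)])
    then show ?thesis using U[of "f w" "{g w}"] by auto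
  qed
  then have "Measurable.pred N (\<lambda>w. f w = g w) \<longleftrightarrow> Measurable.pred N (\<lambda>w. \<forall>n. \<not> (f w \<in> U n \<and> g w \<notin> U n))"
    by (rule measurable_cong)
  also have "\<dots>" by measurable
  finally show ?thesis .
qed

lemma le_fun_diff_add: "a \<le> b \<Longrightarrow> b - a + a = b" for a b :: "'i \<Rightarrow> nat"
  by (auto simp: le_fun_def fun_eq_iff)

text \<open>An exponent vector \<open>a\<close> stands for the product of the powers \<open>a i\<close> of commuting maps indexed by \<open>I\<close>.
Working with exponent vectors, and not with the products in a monoid, makes differences available
even if the monoid has no cancellation.\<close>

locale commuting_maps =
  fixes X :: "'x measure" and I :: "'i set" and T :: "('i \<Rightarrow> nat) \<Rightarrow> 'x \<Rightarrow> 'x"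
  assumes X: "standard_borel X" and finite_I: "finite I"
    and T_meas[measurable]: "T a \<in> measurable X X"
    and T_zero[simp]: "x \<in> space X \<Longrightarrow> T 0 x = x"
    and T_add: "x \<in> space X \<Longrightarrow> T (a + b) x = T a (T b x)"
    and bounded: "\<exists>b::nat. \<forall>y\<in>space X. finite {x\<in>space X. T a x = y} \<and> card {x\<in>space X. T a x = y} \<le> b"
begin

lemma T_space[simp]: "x \<in> space X \<Longrightarrow> T a x \<in> space X"
  using measurable_space[OF T_meas] by blast

text \<open>The vectors below \<open>box L\<close> form a window of side \<open>L\<close>. It vanishes off \<open>I\<close> so that windows are finite.\<close>

definition box :: "nat \<Rightarrow> 'i \<Rightarrow> nat" where
  "box L = (\<lambda>i. if i \<in> I then L else 0)"

definition unit :: "'i \<Rightarrow> 'i \<Rightarrow> nat" where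
  "unit i = (\<lambda>j. if j = i then 1 else 0)"

text \<open>Points are near if they have a common forward image within a window. As the maps commute, this is
additive along paths, so endpoints of a path of \<open>L\<close> edges satisfy \<open>near L\<close>.\<close>

definition near :: "nat \<Rightarrow> 'x \<Rightarrow> 'x \<Rightarrow> bool" where
  "near L x y \<longleftrightarrow> (\<exists>a\<in>{..box L}. \<exists>b\<in>{..box L}. T a x = T b y)"

lemma nearI: "a \<le> box L \<Longrightarrow> b \<le> box L \<Longrightarrow> T a x = T b y \<Longrightarrow> near L x y"
  unfolding near_def by auto

lemma nearE:
  assumes "near L x y" obtains a b where "a \<le> box L" "b \<le> box L" "T a x = T b y"
  using assms unfolding near_def by auto

lemma finite_box: "finite {..box L}"
proof (rule finite_subset)
  show "finite {f. \<forall>x. (x \<in> I \<longrightarrow> f x \<in> {..L}) \<and> (x \<notin> I \<longrightarrow> f x = 0)}"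
    by (rule finite_set_of_finite_funs) (use finite_I in auto)
  show "{..box L} \<subseteq> {f. \<forall>x. (x \<in> I \<longrightarrow> f x \<in> {..L}) \<and> (x \<notin> I \<longrightarrow> f x = 0)}"
  proof
    fix f assume "f \<in> {..box L}"
    then have *: "f i \<le> box L i" for i by (auto simp: le_fun_def)
    have "(i \<in> I \<longrightarrow> f i \<in> {..L}) \<and> (i \<notin> I \<longrightarrow> f i = 0)" for i
      using *[of i] by (simp add: box_def split: if_splits)
    then show "f \<in> {f. \<forall>x. (x \<in> I \<longrightarrow> f x \<in> {..L}) \<and> (x \<notin> I \<longrightarrow> f x = 0)}" by blast
  qed
qed

lemma box_add: "box (L + K) = box L + box K"
  by (auto simp: box_def fun_eq_iff)

lemma box_0: "box 0 = 0"
  by (auto simp: box_def fun_eq_iff)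

lemma box_mono: "L \<le> K \<Longrightarrow> box L \<le> box K"
  by (auto simp: box_def le_fun_def)

lemma zero_le_box: "0 \<le> box L"
  by (auto simp: le_fun_def)

lemma unit_le_box: "i \<in> I \<Longrightarrow> unit i \<le> box 1"
  by (auto simp: unit_def box_def le_fun_def)

lemma near_refl: "x \<in> space X \<Longrightarrow> near L x x"
  by (rule nearI[of 0 _ 0]) (auto simp: zero_le_box)

lemma near_sym: "near L x y \<Longrightarrow> near L y x"
  unfolding near_def by metis

lemma near_trans:
  assumes "near L x y" "near K y z" "x \<in> space X" "y \<in> space X" "z \<in> space X"
  shows "near (L + K) x z"
proof -
  obtain a b where ab: "a \<le> box L" "b \<le> box L" "T a x = T b y" using assms(1) by (rule nearE)
  obtain c d where cd: "c \<le> box K" "d \<le> box K" "T c y = T d z" using assms(2) by (rule nearE)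
  have "T (a + c) x = T (b + d) z"
    using ab cd assms(3-) by (metis T_add add.commute)
  moreover have "a + c \<le> box (L + K)" "b + d \<le> box (L + K)"
    using ab cd by (simp_all add: box_add add_mono)
  ultimately show ?thesis by (rule nearI[rotated 2])
qed

lemma near_mono: "near L x y \<Longrightarrow> L \<le> K \<Longrightarrow> near K x y"
  by (meson box_mono nearE nearI order_trans)

lemma near_T: "x \<in> space X \<Longrightarrow> a \<le> box L \<Longrightarrow> near L x (T a x)"
  by (rule nearI[of a _ 0]) (auto simp: zero_le_box)

lemma near_T_T:
  assumes "near L x y" "x \<in> space X" "y \<in> space X"
  shows "near L (T c x) (T c y)"
proof -
  obtain a b where ab: "a \<le> box L" "b \<le> box L" "T a x = T b y" using assms(1) by (rule nearE)
  then have "T a (T c x) = T b (T c y)" using assms by (metis T_add add.commute)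
  with ab show ?thesis by (auto intro: nearI)
qed

lemmas pred_eq = standard_borel_pred_eq[OF X]

lemma pred_near[measurable (raw)]:
  assumes [measurable]: "f \<in> measurable N X" "g \<in> measurable N X"
  shows "Measurable.pred N (\<lambda>w. near L (f w) (g w))"
  unfolding near_def
  by (intro pred_intros_finite finite_box pred_eq) measurable

lemma near_degree_bounded:
  "\<exists>K. \<forall>x\<in>space X. finite {y\<in>space X. near L x y} \<and> card {y\<in>space X. near L x y} \<le> K"
proof -
  have "\<forall>a. \<exists>b::nat. \<forall>y\<in>space X. finite {x\<in>space X. T a x = y} \<and> card {x\<in>space X. T a x = y} \<le> b"
    using bounded by blast
  then obtain m :: "('i \<Rightarrow> nat) \<Rightarrow> nat" where
    m: "\<forall>a. \<forall>y\<in>space X. finite {x\<in>space X. T a x = y} \<and> card {x\<in>space X. T a x = y} \<le> m a"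
    by (rule choice[THEN exE])
  show ?thesis
  proof (intro exI[of _ "\<Sum>(a, b)\<in>{..box L} \<times> {..box L}. m b"] ballI)
    fix x assume x: "x \<in> space X"
    define N where "N = (\<lambda>(a, b). {y\<in>space X. T b y = T a x})"
    have eq: "{y\<in>space X. near L x y} = (\<Union>p\<in>{..box L} \<times> {..box L}. N p)"
      unfolding near_def N_def by force
    have fin: "finite ({..box L} \<times> {..box L})" using finite_box by simp
    have N: "finite (N p) \<and> card (N p) \<le> (case p of (a, b) \<Rightarrow> m b)" for p
      using m x unfolding N_def by (auto split: prod.split)
    have "card (\<Union>p\<in>{..box L} \<times> {..box L}. N p) \<le> (\<Sum>p\<in>{..box L} \<times> {..box L}. card (N p))"
      by (rule card_UN_le[OF fin])
    also have "\<dots> \<le> (\<Sum>(a, b)\<in>{..box L} \<times> {..box L}. m b)"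
      by (rule sum_mono) (use N in auto)
    finally show "finite {y\<in>space X. near L x y} \<and>
        card {y\<in>space X. near L x y} \<le> (\<Sum>(a, b)\<in>{..box L} \<times> {..box L}. m b)"
      unfolding eq using fin N by auto
  qed
qed

text \<open>Every point selects a set of a separating sequence that contains it but none of its finitely many
neighbours; two neighbours cannot select the same set.\<close>

lemma countable_borel_coloring:
  obtains c :: "'x \<Rightarrow> nat" where "c \<in> measurable X (count_space UNIV)"
    "\<And>x y. \<lbrakk>x \<in> space X; y \<in> space X; near L x y; x \<noteq> y\<rbrakk> \<Longrightarrow> c x \<noteq> c y"
proof -
  obtain U where [measurable]: "\<And>n. U n \<in> sets X"
    and U: "\<And>x F. \<lbrakk>x \<in> space X; finite F; F \<subseteq> space X; x \<notin> F\<rbrakk> \<Longrightarrow> \<exists>n::nat. x \<in> U n \<and> F \<inter> U n = {}"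
    using standard_borel_separating_sequence[OF X] by metis
  have K: "finite {y\<in>space X. near L x y}" if "x \<in> space X" for x
    using near_degree_bounded that by blast
  define R where "R = (\<lambda>n. {z \<in> space (X \<Otimes>\<^sub>M X). fst z \<notin> U n \<or>
     (near L (fst z) (snd z) \<and> fst z \<noteq> snd z \<and> snd z \<in> U n)})"
  have [measurable]: "Measurable.pred (X \<Otimes>\<^sub>M X) (\<lambda>z. fst z = snd z)"
    by (rule pred_eq) measurable
  have "R n \<in> sets (X \<Otimes>\<^sub>M X)" for n unfolding R_def by measurable
  moreover have "\<exists>n. \<forall>y\<in>space X. (x, y) \<notin> R n" if x: "x \<in> space X" for x
  proof -
    obtain n where "x \<in> U n" "({y\<in>space X. near L x y} - {x}) \<inter> U n = {}"
      using U[of x "{y\<in>space X. near L x y} - {x}"] x K by auto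
    then show ?thesis by (intro exI[of _ n]) (auto simp: R_def)
  qed
  ultimately obtain c where c: "c \<in> measurable X (count_space UNIV)"
    "\<And>x y. \<lbrakk>x \<in> space X; y \<in> space X\<rbrakk> \<Longrightarrow> (x, y) \<notin> R (c x)"
    using coanalytic_selection[OF X] by metis
  show thesis
  proof
    fix x y assume xy: "x \<in> space X" "y \<in> space X" "near L x y" "x \<noteq> y"
    have "y \<in> U (c y)" using c(2)[of y y] xy by (auto simp: R_def space_pair_measure)
    moreover have "y \<notin> U (c x)" using c(2)[of x y] xy by (auto simp: R_def space_pair_measure)
    ultimately show "c x \<noteq> c y" by auto
  qed (fact c(1))
qed

text \<open>Greedy recoloring: the classes of a countable Borel coloring are treated one after the other, and a
point of the current class selects a color that its earlier neighbours do not use. A degree bound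
\<open>K\<close> leaves a free color among \<open>Suc K\<close>.\<close>

lemma finite_borel_coloring:
  obtains K :: nat and c :: "'x \<Rightarrow> nat" where "c \<in> measurable X (count_space UNIV)"
    "\<And>x. x \<in> space X \<Longrightarrow> c x < K"
    "\<And>x y. \<lbrakk>x \<in> space X; y \<in> space X; near L x y; x \<noteq> y\<rbrakk> \<Longrightarrow> c x \<noteq> c y"
proof -
  obtain c where c[measurable]: "c \<in> measurable X (count_space UNIV)"
    and proper: "\<And>x y. \<lbrakk>x \<in> space X; y \<in> space X; near L x y; x \<noteq> y\<rbrakk> \<Longrightarrow> c x \<noteq> (c y :: nat)"
    by (rule countable_borel_coloring[of L]) blast
  obtain K where K: "\<And>x. x \<in> space X \<Longrightarrow> finite {y\<in>space X. near L x y}"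
    "\<And>x. x \<in> space X \<Longrightarrow> card {y\<in>space X. near L x y} \<le> K"
    using near_degree_bounded by blast
  have [measurable]: "Measurable.pred (X \<Otimes>\<^sub>M X) (\<lambda>z. fst z = snd z)"
    by (rule pred_eq) measurable
  define P where "P = (\<lambda>n g. g \<in> measurable X (count_space UNIV) \<and> (\<forall>x\<in>space X. g x < Suc K) \<and>
     (\<forall>x\<in>space X. \<forall>y\<in>space X. near L x y \<and> x \<noteq> y \<and> c x < n \<and> c y < n \<longrightarrow> g x \<noteq> (g y :: nat)))"
  define Q where "Q = (\<lambda>n g g'. \<forall>x\<in>space X. c x < n \<longrightarrow> g' x = (g x :: nat))"
  have "\<exists>s. \<forall>n. P n (s n) \<and> Q n (s n) (s (Suc n))"
  proof (rule dependent_nat_choice)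
    show "\<exists>g. P 0 g" by (intro exI[of _ "\<lambda>_. 0"]) (auto simp: P_def)
    fix g n assume g: "P n g"
    then have [measurable]: "g \<in> measurable X (count_space UNIV)" by (simp add: P_def)
    define R where "R = (\<lambda>i. {z \<in> space (X \<Otimes>\<^sub>M X). \<not> i < Suc K \<or>
       (near L (fst z) (snd z) \<and> fst z \<noteq> snd z \<and> c (snd z) < n \<and> g (snd z) = i)})"
    have "R i \<in> sets (X \<Otimes>\<^sub>M X)" for i unfolding R_def by measurable
    moreover have "\<exists>i. \<forall>y\<in>space X. (x, y) \<notin> R i" if x: "x \<in> space X" for x
    proof -
      have "card (g ` {y\<in>space X. near L x y}) \<le> K"
        using card_image_le[OF K(1)[OF x], of g] K(2)[OF x] by linarith
      then have "card (g ` {y\<in>space X. near L x y}) < card {..<Suc K}" by simp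
      then have "\<not> {..<Suc K} \<subseteq> g ` {y\<in>space X. near L x y}"
        using card_mono[of "g ` {y\<in>space X. near L x y}" "{..<Suc K}"] K(1)[OF x] by auto
      then obtain i where "i < Suc K" "i \<notin> g ` {y\<in>space X. near L x y}" by blast
      then show ?thesis by (intro exI[of _ i]) (auto simp: R_def)
    qed
    ultimately obtain f where f[measurable]: "f \<in> measurable X (count_space UNIV)"
      and fR: "\<And>x y. \<lbrakk>x \<in> space X; y \<in> space X\<rbrakk> \<Longrightarrow> (x, y) \<notin> R (f x)"
      using coanalytic_selection[OF X] by metis
    have f_less: "f x < Suc K" if "x \<in> space X" for x
      using fR[OF that that] that by (auto simp: R_def space_pair_measure)
    have f_ne: "f x \<noteq> g y" if "x \<in> space X" "y \<in> space X" "near L x y" "x \<noteq> y" "c y < n" for x y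
      using fR[OF that(1,2)] that by (auto simp: R_def space_pair_measure)
    define g' where "g' = (\<lambda>x. if c x = n then f x else g x)"
    have "g' \<in> measurable X (count_space UNIV)" unfolding g'_def by measurable
    moreover have "g' x < Suc K" if "x \<in> space X" for x
      using f_less[OF that] g that by (simp add: g'_def P_def)
    moreover have "g' x \<noteq> g' y" if xy: "x \<in> space X" "y \<in> space X" "near L x y" "x \<noteq> y"
        "c x < Suc n" "c y < Suc n" for x y
    proof -
      have ne: "c x \<noteq> c y" using proper xy by blast
      consider "c x = n" "c y < n" | "c y = n" "c x < n" | "c x < n" "c y < n"
        using xy ne by linarith
      then show ?thesis
      proof cases
        case 1 then show ?thesis using f_ne[of x y] xy by (simp add: g'_def)
      next
        case 2 then show ?thesis using f_ne[of y x] xy near_sym[OF xy(3)] by (auto simp: g'_def)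
      next
        case 3 then show ?thesis using g xy by (auto simp: g'_def P_def)
      qed
    qed
    ultimately have "P (Suc n) g'" unfolding P_def by blast
    moreover have "Q n g g'" unfolding Q_def g'_def by auto
    ultimately show "\<exists>g'. P (Suc n) g' \<and> Q n g g'" by blast
  qed
  then obtain s where s: "\<And>n. P n (s n)" "\<And>n. Q n (s n) (s (Suc n))" by blast
  have stable: "s m x = s (Suc (c x)) x" if "x \<in> space X" "c x < m" for m x
    using that(2)
  proof (induction m)
    case (Suc m)
    then show ?case using s(2)[of m] that(1) unfolding Q_def by (cases "c x = m") auto
  qed simp
  show thesis
  proof
    have [measurable]: "s n \<in> measurable X (count_space UNIV)" for n using s(1) by (simp add: P_def)
    show "(\<lambda>x. s (Suc (c x)) x) \<in> measurable X (count_space UNIV)"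
      by (rule measurable_compose_countable[of "\<lambda>n x. s (Suc n) x"]) measurable
    show "s (Suc (c x)) x < Suc K" if "x \<in> space X" for x using s(1) that by (simp add: P_def)
    fix x y assume xy: "x \<in> space X" "y \<in> space X" "near L x y" "x \<noteq> y"
    define n where "n = Suc (max (c x) (c y))"
    have "c x < n" "c y < n" by (auto simp: n_def)
    then have "s n x \<noteq> s n y" using s(1)[of n] xy unfolding P_def by blast
    then show "s (Suc (c x)) x \<noteq> s (Suc (c y)) y"
      using stable[of x n] stable[of y n] xy by (auto simp: n_def)
  qed
qed

text \<open>The points of a fibre of \<open>P\<close> have distinct colors under a finite Borel coloring \<open>h\<close>, so a \<open>k\<close>-coloring
of the fibre has the form \<open>f \<circ> h\<close> with \<open>f\<close> from a finite list of functions. That \<open>f\<close> works for the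
fibre over \<open>p\<close> is a coanalytic condition on \<open>p\<close>.\<close>

lemma fibrewise_coloring:
  assumes Y[measurable]: "Y \<in> sets X" and P[measurable]: "P \<in> measurable X X"
    and PR: "\<And>x. x \<in> Y \<Longrightarrow> \<exists>a\<le>box R. P x = T a x"
    and k: "k > 0"
    and col: "\<And>x. x \<in> space X \<Longrightarrow> col x < (k::nat)"
      "\<And>x i. \<lbrakk>x \<in> space X; i \<in> I; T (unit i) x \<noteq> x\<rbrakk> \<Longrightarrow> col x \<noteq> col (T (unit i) x)"
  obtains c :: "'x \<Rightarrow> nat" where "c \<in> measurable X (count_space UNIV)"
    "\<And>x. x \<in> space X \<Longrightarrow> c x < k"
    "\<And>x i. \<lbrakk>x \<in> Y; i \<in> I; T (unit i) x \<in> Y; P (T (unit i) x) = P x; T (unit i) x \<noteq> x\<rbrakk>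
       \<Longrightarrow> c x \<noteq> c (T (unit i) x)"
proof -
  obtain K h where [measurable]: "h \<in> measurable X (count_space UNIV)"
    and h: "\<And>x. x \<in> space X \<Longrightarrow> h x < K"
    "\<And>x y. \<lbrakk>x \<in> space X; y \<in> space X; near R x y; x \<noteq> y\<rbrakk> \<Longrightarrow> h x \<noteq> (h y :: nat)"
    by (rule finite_borel_coloring[of R]) blast
  have Ysub: "Y \<subseteq> space X" using Y by (rule sets.sets_into_space)
  define F where "F = PiE {..<K} (\<lambda>_. {..<k})"
  have "finite F" unfolding F_def by (intro finite_PiE) auto
  moreover have "(\<lambda>i\<in>{..<K}. 0) \<in> F" using k by (auto simp: F_def)
  ultimately have rF: "range (from_nat_into F) = F"
    by (intro range_from_nat_into) (auto intro: countable_finite)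
  define \<phi> where "\<phi> = from_nat_into F"
  have \<phi>: "\<phi> n v < k" if "v < K" for n v
  proof -
    have "\<phi> n \<in> F" using rF unfolding \<phi>_def by auto
    then show ?thesis using that by (auto simp: F_def PiE_iff)
  qed
  define B where "B = (\<lambda>n z. snd z \<in> Y \<and> P (snd z) = fst z \<and>
    (\<exists>i\<in>I. T (unit i) (snd z) \<in> Y \<and> P (T (unit i) (snd z)) = P (snd z) \<and> T (unit i) (snd z) \<noteq> snd z \<and>
      \<phi> n (h (snd z)) = \<phi> n (h (T (unit i) (snd z)))))"
  have eqs: "Measurable.pred (X \<Otimes>\<^sub>M X) (\<lambda>z. P (snd z) = fst z)"
    "Measurable.pred (X \<Otimes>\<^sub>M X) (\<lambda>z. P (T (unit i) (snd z)) = P (snd z))"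
    "Measurable.pred (X \<Otimes>\<^sub>M X) (\<lambda>z. T (unit i) (snd z) = snd z)" for i
    by (rule pred_eq; measurable)+
  define q where "q n x = \<phi> n (h x)" for n x
  have q[measurable]: "q n \<in> measurable X (count_space UNIV)" for n
    unfolding q_def[abs_def] by (rule measurable_compose[of h _ "count_space UNIV"]) auto
  have "Measurable.pred (X \<Otimes>\<^sub>M X) (B n)" for n
  proof -
    have [measurable]: "Measurable.pred (X \<Otimes>\<^sub>M X) (\<lambda>z. snd z \<in> Y)" by measurable
    have TY: "Measurable.pred (X \<Otimes>\<^sub>M X) (\<lambda>z. T (unit i) (snd z) \<in> Y)" for i by measurable
    have qq: "Measurable.pred (X \<Otimes>\<^sub>M X) (\<lambda>z. q n (snd z) = q n (T (unit i) (snd z)))" for i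
      by (rule measurable_compose_countable[of "\<lambda>v z. v = q n (T (unit i) (snd z))" _ _ "\<lambda>z. q n (snd z)"])
        measurable
    show ?thesis
      unfolding B_def q_def[symmetric]
      by (intro pred_intros_logic pred_intros_finite finite_I eqs TY qq) measurable
  qed
  then have "{z \<in> space (X \<Otimes>\<^sub>M X). B n z} \<in> sets (X \<Otimes>\<^sub>M X)" for n by (simp add: pred_def)
  moreover have "\<exists>n. \<forall>x\<in>space X. (p, x) \<notin> {z \<in> space (X \<Otimes>\<^sub>M X). B n z}" if p: "p \<in> space X" for p
  proof -
    define D where "D = {x\<in>Y. P x = p}"
    have inj: "inj_on h D"
    proof (rule inj_onI, rule ccontr)
      fix x y assume xy: "x \<in> D" "y \<in> D" "h x = h y" "x \<noteq> y"
      then obtain a b where "a \<le> box R" "b \<le> box R" "P x = T a x" "P y = T b y"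
        using PR unfolding D_def by blast
      then have "near R x y" using xy by (intro nearI[of a R b]) (auto simp: D_def)
      then show False using h(2)[of x y] xy Ysub by (auto simp: D_def)
    qed
    define f where "f = (\<lambda>v\<in>{..<K}. if v \<in> h ` D then col (the_inv_into D h v) else 0)"
    have DX: "D \<subseteq> space X" using Ysub by (auto simp: D_def)
    have fcol: "f (h x) = col x" if "x \<in> D" for x
      using that DX h(1) by (auto simp: f_def the_inv_into_f_f[OF inj])
    have "f \<in> F" unfolding F_def
    proof (rule PiE_I)
      fix v assume v: "v \<in> {..<K}"
      show "f v \<in> {..<k}"
      proof (cases "v \<in> h ` D")
        case True
        then obtain x where "x \<in> D" "v = h x" by auto
        then show ?thesis using fcol col(1) DX by auto
      qed (use v k in \<open>auto simp: f_def\<close>)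
    qed (auto simp: f_def)
    then obtain n where n: "f = \<phi> n" using rF unfolding \<phi>_def by (metis imageE)
    have "\<not> B n (p, x)" for x
    proof
      assume "B n (p, x)"
      then obtain i where i: "i \<in> I" "x \<in> D" "T (unit i) x \<in> D" "T (unit i) x \<noteq> x"
        "\<phi> n (h x) = \<phi> n (h (T (unit i) x))" unfolding B_def D_def by auto
      then have "col x = col (T (unit i) x)" using fcol n by metis
      then show False using col(2)[of x i] i DX by auto
    qed
    then show ?thesis by blast
  qed
  ultimately obtain s where s[measurable]: "s \<in> measurable X (count_space UNIV)"
    and sB: "\<And>p x. \<lbrakk>p \<in> space X; x \<in> space X\<rbrakk> \<Longrightarrow> (p, x) \<notin> {z \<in> space (X \<Otimes>\<^sub>M X). B (s p) z}"
    using coanalytic_selection[OF X, of "\<lambda>n. {z \<in> space (X \<Otimes>\<^sub>M X). B n z}"] by blast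
  have Psp: "P x \<in> space X" if "x \<in> space X" for x using measurable_space[OF P that] .
  show thesis
  proof
    show "(\<lambda>x. \<phi> (s (P x)) (h x)) \<in> measurable X (count_space UNIV)"
      unfolding q_def[symmetric] by (rule measurable_compose_countable[of q]) measurable
    show "\<phi> (s (P x)) (h x) < k" if "x \<in> space X" for x
      using \<phi> h(1) that by auto
    fix x i assume x: "x \<in> Y" "i \<in> I" "T (unit i) x \<in> Y" "P (T (unit i) x) = P x" "T (unit i) x \<noteq> x"
    have "\<not> B (s (P x)) (P x, x)"
      using sB[of "P x" x] x Ysub Psp by (auto simp: space_pair_measure)
    then show "\<phi> (s (P x)) (h x) \<noteq> \<phi> (s (P (T (unit i) x))) (h (T (unit i) x))"
      using x unfolding B_def by auto
  qed
qed

end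

section \<open>Markers and covers at a given scale\<close>

context commuting_maps
begin

lemma T_box_box: "x \<in> space X \<Longrightarrow> T (box m) (T (box n) x) = T (box (m + n)) x"
  by (simp add: T_add box_add)

lemma T_commute: "x \<in> space X \<Longrightarrow> T a (T b x) = T b (T a x)"
  by (metis T_add add.commute)

lemma box_le_add: "v \<le> box m \<Longrightarrow> w \<le> box n \<Longrightarrow> v + w \<le> box (m + n)"
  by (simp add: box_add add_mono)

text \<open>A relative maximal independent set, decided by looking forward only. That \<open>x\<close> belongs to \<open>B\<close> means
that the shifted point \<open>T (box t) x\<close> is a marker. Markers lie in \<open>Y\<close>, near markers coincide, and a
point of \<open>Y\<close> sees a marker in the window of side \<open>2 * L\<close>, whose centre represents the point itself.
The classes of a finite Borel coloring are treated in turn, and each of them costs one further shift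
by \<open>box L\<close>, which turns the neighbourhood of a point into a window of its forward orbit. Finitely many
colors are needed to make the total shift \<open>t\<close> finite.\<close>

lemma markers:
  assumes Y[measurable]: "Y \<in> sets X"
  obtains t B where "B \<in> sets X"
    "\<And>x. x \<in> B \<Longrightarrow> T (box t) x \<in> Y"
    "\<And>x y. \<lbrakk>x \<in> B; y \<in> B; near L x y\<rbrakk> \<Longrightarrow> T (box t) x = T (box t) y"
    "\<And>x. \<lbrakk>x \<in> space X; T (box (t + L)) x \<in> Y\<rbrakk> \<Longrightarrow> \<exists>v\<le>box (2 * L). T v x \<in> B"
proof -
  obtain K c where c[measurable]: "c \<in> measurable X (count_space UNIV)"
    and c_less: "\<And>x. x \<in> space X \<Longrightarrow> c x < (K::nat)"
    and c_ne: "\<And>x y. \<lbrakk>x \<in> space X; y \<in> space X; near L x y; x \<noteq> y\<rbrakk> \<Longrightarrow> c x \<noteq> (c y::nat)"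
    by (rule finite_borel_coloring[of L]) blast
  (* After j classes a point represents the candidate that lies box (j * L) ahead of it. It is
     a marker if it already was one, or if it has color j, lies in Y and has no marker in its window. *)
  define B where "B = rec_nat {} (\<lambda>j Bj. {x \<in> space X. T (box L) x \<in> Bj \<or>
     (c (T (box (Suc j * L)) x) = j \<and> T (box (Suc j * L)) x \<in> Y \<and> \<not> (\<exists>v\<in>{..box (2 * L)}. T v x \<in> Bj))})"
  have B_0: "B 0 = {}" by (simp add: B_def)
  have B_Suc: "x \<in> B (Suc j) \<longleftrightarrow> x \<in> space X \<and> (T (box L) x \<in> B j \<or>
     (c (T (box (Suc j * L)) x) = j \<and> T (box (Suc j * L)) x \<in> Y \<and> \<not> (\<exists>v\<in>{..box (2 * L)}. T v x \<in> B j)))" for x j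
    by (simp add: B_def)
  have B_sets: "B j \<in> sets X" for j
  proof (induction j)
    case (Suc j)
    then have [measurable]: "B j \<in> sets X" .
    have [measurable]: "Measurable.pred X (\<lambda>x. \<exists>v\<in>{..box (2 * L)}. T v x \<in> B j)"
      by (intro pred_intros_finite finite_box) measurable
    have "B (Suc j) = {x \<in> space X. T (box L) x \<in> B j \<or>
     (c (T (box (Suc j * L)) x) = j \<and> T (box (Suc j * L)) x \<in> Y \<and> \<not> (\<exists>v\<in>{..box (2 * L)}. T v x \<in> B j))}"
      using B_Suc by blast
    also have "\<dots> \<in> sets X" by measurable
    finally show ?case .
  qed (simp add: B_0)
  have B_space: "x \<in> space X" if "x \<in> B j" for x j
    using sets.sets_into_space[OF B_sets] that by blast
  have B_Y: "T (box (j * L)) x \<in> Y" if "x \<in> B j" for x j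
    using that
  proof (induction j arbitrary: x)
    case (Suc j)
    have x: "x \<in> space X" using Suc.prems by (rule B_space)
    show ?case
    proof (cases "T (box L) x \<in> B j")
      case True
      then show ?thesis using Suc.IH x by (metis T_box_box mult_Suc add.commute)
    qed (use Suc.prems in \<open>simp add: B_Suc\<close>)
  qed (simp add: B_0)
  have B_sep: "T (box (j * L)) x = T (box (j * L)) y" if "x \<in> B j" "y \<in> B j" "near L x y" for x y j
    using that
  proof (induction j arbitrary: x y)
    case (Suc j)
    have xy: "x \<in> space X" "y \<in> space X" using Suc.prems B_space by blast+
    (* A point that became a marker earlier lies in the window around every point near it. *)
    have window: "\<exists>v\<in>{..box (2 * L)}. T v y \<in> B j" if B: "T (box L) x \<in> B j" and xy: "near L x y" "x \<in> space X" "y \<in> space X" for x y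
    proof -
      obtain a b where ab: "a \<le> box L" "b \<le> box L" "T a x = T b y" using xy(1) by (rule nearE)
      have "T (box L) x = T (box L - a) (T a x)"
        using xy ab(1) by (simp add: T_add[symmetric] le_fun_diff_add)
      also have "\<dots> = T (box L - a + b) y" using xy ab(3) by (simp add: T_add)
      finally have "T (box L) x = T (box L - a + b) y" .
      moreover have "box L - a + b \<le> box (2 * L)"
        unfolding mult_2 by (rule box_le_add[OF _ ab(2)]) (simp add: le_fun_def)
      ultimately show ?thesis using B by auto
    qed
    consider "T (box L) x \<in> B j" "T (box L) y \<in> B j"
      | "T (box L) x \<in> B j" "T (box L) y \<notin> B j" | "T (box L) x \<notin> B j" "T (box L) y \<in> B j"
      | "T (box L) x \<notin> B j" "T (box L) y \<notin> B j" by blast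
    then show ?case
    proof cases
      case 1
      then have "T (box (j * L)) (T (box L) x) = T (box (j * L)) (T (box L) y)"
        using Suc.IH near_T_T Suc.prems(3) xy by blast
      then show ?thesis using xy by (simp add: T_box_box add.commute)
    next
      case 2
      then show ?thesis using window[of x y] Suc.prems xy by (simp add: B_Suc)
    next
      case 3
      then show ?thesis using window[of y x] Suc.prems xy near_sym by (simp add: B_Suc)
    next
      case 4
      then have "c (T (box (Suc j * L)) x) = j" "c (T (box (Suc j * L)) y) = j"
        using Suc.prems by (auto simp: B_Suc)
      then show ?thesis using c_ne near_T_T[OF Suc.prems(3) xy] xy by (metis T_space)
    qed
  qed (simp add: B_0)
  have push: "x \<in> B (j + m)" if "x \<in> space X" "T (box (m * L)) x \<in> B j" for x j m
    using that
  proof (induction m arbitrary: x)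
    case (Suc m)
    have "T (box (m * L)) (T (box L) x) \<in> B j"
      using Suc.prems by (simp add: T_box_box add.commute)
    then have "T (box L) x \<in> B (j + m)" using Suc.IH Suc.prems(1) by simp
    then show ?case using Suc.prems(1) by (simp add: B_Suc)
  qed (simp add: box_0)
  show thesis
  proof
    show "B K \<in> sets X" by (rule B_sets)
    show "T (box (K * L)) x \<in> Y" if "x \<in> B K" for x using B_Y[OF that] .
    show "T (box (K * L)) x = T (box (K * L)) y" if "x \<in> B K" "y \<in> B K" "near L x y" for x y
      using B_sep[OF that] .
    fix x assume x: "x \<in> space X" and xY: "T (box (K * L + L)) x \<in> Y"
    define j where "j = c (T (box (K * L + L)) x)"
    have j: "j < K" using c_less x by (simp add: j_def)
    define z where "z = T (box ((K - j) * L)) x"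
    have z: "z \<in> space X" using x by (simp add: z_def)
    have "Suc j * L + (K - j) * L = K * L + L"
      using j by (simp add: add_mult_distrib[symmetric])
    then have pz: "T (box (Suc j * L)) z = T (box (K * L + L)) x"
      unfolding z_def using T_box_box[OF x, of "Suc j * L" "(K - j) * L"] by metis
    show "\<exists>v\<le>box (2 * L). T v x \<in> B K"
    proof (cases "\<exists>v\<in>{..box (2 * L)}. T v z \<in> B j")
      case True
      then obtain v where v: "v \<le> box (2 * L)" "T v z \<in> B j" by auto
      then have "T (box ((K - j) * L)) (T v x) \<in> B j"
        unfolding z_def using T_commute[OF x] by metis
      then have "T v x \<in> B (j + (K - j))" using push x by simp
      then show ?thesis using v(1) j by auto
    next
      case False
      then have "z \<in> B (Suc j)" using z xY pz j_def unfolding B_Suc by metis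
      moreover have "z = T (box ((K - Suc j) * L)) (T (box L) x)"
      proof -
        have "(K - Suc j) * L + L = (K - j) * L" using j by (metis Suc_diff_Suc add.commute mult_Suc)
        then show ?thesis unfolding z_def using T_box_box[OF x] by metis
      qed
      ultimately have "T (box L) x \<in> B (Suc j + (K - Suc j))"
        using push[of "T (box L) x" "K - Suc j" "Suc j"] x by simp
      moreover have "Suc j + (K - Suc j) = K" using j by simp
      moreover have "box L \<le> box (2 * L)" by (rule box_mono) simp
      ultimately show ?thesis by auto
    qed
  qed
qed

text \<open>After \<open>i\<close> rounds there are \<open>i\<close> families of markers, all at the common shift \<open>t\<close>. Round \<open>i\<close> chooses
\<open>L\<close>-separated markers among the points that are further than \<open>\<rho>\<close> from all markers of the earlier
rounds. So a point that stays uncovered sees a marker of every family within distance \<open>L\<close>, while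
markers of different families are never \<open>\<rho>\<close>-near. The vector \<open>box L\<close> is the centre of the window, so
\<open>box (L - \<rho>) \<le> w \<le> box (L + \<rho>)\<close> says that the marker at position \<open>w\<close> is within \<open>\<rho>\<close> of the point.\<close>

lemma marker_families:
  fixes i :: nat
  assumes "\<rho> \<le> L"
  shows "\<exists>t A. (\<forall>j<i. A j \<in> sets X) \<and>
    (\<forall>j<i. \<forall>x\<in>A j. \<forall>y\<in>A j. near L x y \<longrightarrow> T (box t) x = T (box t) y) \<and>
    (\<forall>j<i. \<forall>j'<i. j \<noteq> j' \<longrightarrow> (\<forall>x\<in>A j. \<forall>y\<in>A j'. \<not> near \<rho> x y)) \<and>
    (\<forall>j<i. \<forall>x\<in>space X. (\<exists>j'<j. \<exists>w. box (L - \<rho>) \<le> w \<and> w \<le> box (L + \<rho>) \<and> T w x \<in> A j') \<or>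
        (\<exists>w\<le>box (2 * L). T w x \<in> A j))"
proof (induction i)
  case 0
  show ?case by auto
next
  case (Suc i)
  then obtain t A where A1: "\<forall>j<i. A j \<in> sets X"
    and A2: "\<forall>j<i. \<forall>x\<in>A j. \<forall>y\<in>A j. near L x y \<longrightarrow> T (box t) x = T (box t) y"
    and A3: "\<forall>j<i. \<forall>j'<i. j \<noteq> j' \<longrightarrow> (\<forall>x\<in>A j. \<forall>y\<in>A j'. \<not> near \<rho> x y)"
    and A4: "\<forall>j<i. \<forall>x\<in>space X. (\<exists>j'<j. \<exists>w. box (L - \<rho>) \<le> w \<and> w \<le> box (L + \<rho>) \<and> T w x \<in> A j') \<or>
        (\<exists>w\<le>box (2 * L). T w x \<in> A j)"
    by (elim exE conjE)
  note A = A1[rule_format] A2[rule_format] A3[rule_format] A4[rule_format]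
  define Y where "Y = {x \<in> space X. \<not> (\<exists>j\<in>{..<i}. \<exists>v\<in>{..box (2 * \<rho>)}. T v x \<in> A j)}"
  have "Measurable.pred X (\<lambda>x. \<exists>j\<in>{..<i}. \<exists>v\<in>{..box (2 * \<rho>)}. T v x \<in> A j)"
  proof (intro pred_intros_finite finite_box finite_lessThan)
    fix j v assume "j \<in> {..<i}"
    then have [measurable]: "A j \<in> sets X" using A(1) by simp
    show "Measurable.pred X (\<lambda>x. T v x \<in> A j)" by measurable
  qed
  then have "Y \<in> sets X" unfolding Y_def by measurable
  then obtain t' B where B: "B \<in> sets X"
    "\<And>x. x \<in> B \<Longrightarrow> T (box t') x \<in> Y"
    "\<And>x y. \<lbrakk>x \<in> B; y \<in> B; near L x y\<rbrakk> \<Longrightarrow> T (box t') x = T (box t') y"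
    "\<And>x. \<lbrakk>x \<in> space X; T (box (t' + L)) x \<in> Y\<rbrakk> \<Longrightarrow> \<exists>v\<le>box (2 * L). T v x \<in> B"
    by (rule markers[of Y L]) blast
  have B_space: "x \<in> space X" if "x \<in> B" for x using sets.sets_into_space[OF B(1)] that by blast
  define A' where "A' = (\<lambda>j. if j = i then B else {x \<in> space X. T (box (\<rho> + t')) x \<in> A j})"
  have cross: "\<not> near \<rho> x y" if x: "x \<in> B" and y: "y \<in> space X" "T (box (\<rho> + t')) y \<in> A j" and j: "j < i" for x y j
  proof
    assume "near \<rho> x y"
    then obtain a b where ab: "a \<le> box \<rho>" "b \<le> box \<rho>" "T a x = T b y" by (rule nearE)
    have xs: "x \<in> space X" using x by (rule B_space)
    define v where "v = box \<rho> - b + a"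
    have "T (box \<rho> - b) (T b y) = T (box \<rho>) y"
      using y(1) ab(2) by (simp add: T_add[symmetric] le_fun_diff_add)
    then have "T (box (\<rho> + t')) y = T (box t') (T (box \<rho> - b) (T b y))"
      using T_box_box[OF y(1), of t' \<rho>] by (simp add: add.commute)
    also have "\<dots> = T (box t') (T v x)" unfolding v_def ab(3)[symmetric] using xs by (simp add: T_add)
    also have "\<dots> = T v (T (box t') x)" using xs by (rule T_commute)
    finally have "T v (T (box t') x) \<in> A j" using y(2) by simp
    moreover have "v \<le> box (2 * \<rho>)"
      unfolding mult_2 v_def by (rule box_le_add[OF _ ab(1)]) (simp add: le_fun_def)
    ultimately show False using B(2)[OF x] j by (auto simp: Y_def)
  qed
  show ?case
  proof (intro exI[of _ "t + (\<rho> + t')"] exI[of _ A'] conjI allI impI ballI)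
    fix j assume j: "j < Suc i"
    have [measurable]: "A j \<in> sets X" if "j \<noteq> i" using A(1) j that by simp
    show "A' j \<in> sets X"
      by (cases "j = i") (use B(1) in \<open>simp_all add: A'_def\<close>)
    show "T (box (t + (\<rho> + t'))) x = T (box (t + (\<rho> + t'))) y"
      if xy: "x \<in> A' j" "y \<in> A' j" "near L x y" for x y
    proof (cases "j = i")
      case True
      then have "x \<in> B" "y \<in> B" using xy by (auto simp: A'_def)
      then have "T (box (t + \<rho>)) (T (box t') x) = T (box (t + \<rho>)) (T (box t') y)" "x \<in> space X" "y \<in> space X"
        using B(3)[of x y] xy(3) B_space by simp_all
      then show ?thesis by (simp add: T_box_box add.assoc)
    next
      case False
      then have "x \<in> space X" "y \<in> space X" "T (box (\<rho> + t')) x \<in> A j" "T (box (\<rho> + t')) y \<in> A j"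
        using xy by (auto simp: A'_def)
      moreover from this have "near L (T (box (\<rho> + t')) x) (T (box (\<rho> + t')) y)"
        using near_T_T[OF xy(3)] by blast
      ultimately have "T (box t) (T (box (\<rho> + t')) x) = T (box t) (T (box (\<rho> + t')) y)"
        using A(2)[of j "T (box (\<rho> + t')) x" "T (box (\<rho> + t')) y"] j False by simp
      then show ?thesis using \<open>x \<in> space X\<close> \<open>y \<in> space X\<close> by (simp add: T_box_box)
    qed
    show "\<not> near \<rho> x y" if "j' < Suc i" "j \<noteq> j'" "x \<in> A' j" "y \<in> A' j'" for j' x y
    proof (cases "j = i")
      case True
      then show ?thesis using that cross[of x y j'] by (auto simp: A'_def)
    next
      case ji: False
      show ?thesis
      proof (cases "j' = i")
        case True
        then show ?thesis using that j ji cross[of y x j] near_sym by (auto simp: A'_def)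
      next
        case False
        then have "\<not> near \<rho> (T (box (\<rho> + t')) x) (T (box (\<rho> + t')) y)"
          using that j ji A(3)[of j j'] by (auto simp: A'_def)
        moreover have "x \<in> space X" "y \<in> space X" using that ji False by (auto simp: A'_def)
        ultimately show ?thesis using near_T_T by blast
      qed
    qed
    fix x assume x: "x \<in> space X"
    show "(\<exists>j'<j. \<exists>w. box (L - \<rho>) \<le> w \<and> w \<le> box (L + \<rho>) \<and> T w x \<in> A' j') \<or>
        (\<exists>w\<le>box (2 * L). T w x \<in> A' j)"
    proof (cases "j = i")
      case False
      then have "j < i" using j by simp
      have lift: "T w x \<in> A' j'" if "T w (T (box (\<rho> + t')) x) \<in> A j'" "j' < i" for w j'
        using that x T_commute[OF x] by (auto simp: A'_def)
      have "T (box (\<rho> + t')) x \<in> space X" using x by simp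
      from A(4)[OF \<open>j < i\<close> this] show ?thesis using lift \<open>j < i\<close> by (meson order.strict_trans)
    next
      case True
      show ?thesis
      proof (cases "T (box (t' + L)) x \<in> Y")
        case True
        then show ?thesis using B(4)[OF x] \<open>j = i\<close> by (auto simp: A'_def)
      next
        case False
        then obtain j' v where v: "j' < i" "v \<le> box (2 * \<rho>)" "T v (T (box (t' + L)) x) \<in> A j'"
          using x by (auto simp: Y_def)
        define w where "w = v + box (L - \<rho>)"
        have "T (box (\<rho> + t')) (T w x) = T v (T (box (\<rho> + t') + box (L - \<rho>)) x)"
          unfolding w_def using x by (simp add: T_add[symmetric] ac_simps)
        also have "box (\<rho> + t') + box (L - \<rho>) = box (t' + L)"
          unfolding box_add[symmetric] using assms by simp
        finally have "T w x \<in> A' j'" using v x by (simp add: A'_def)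
        moreover have "w \<le> box (2 * \<rho> + (L - \<rho>))" unfolding w_def by (rule box_le_add[OF v(2)]) simp
        then have "w \<le> box (L + \<rho>)" using assms by (simp add: algebra_simps mult_2)
        moreover have "box (L - \<rho>) \<le> w" unfolding w_def by (simp add: le_fun_def)
        ultimately show ?thesis using v(1) \<open>j = i\<close> by blast
      qed
    qed
  qed
qed

text \<open>A Borel cover of dimension type at scale \<open>\<rho>\<close>. The set \<open>D j \<sigma>\<close> is the \<open>\<sigma>\<close>-neighbourhood of the
markers of family \<open>j\<close>, and \<open>\<pi> j\<close> sends a point to the marker of its piece; by the last clause pieces
are \<open>4 * \<rho>\<close>-separated, and by the bound \<open>R\<close> on the shift they are bounded.\<close>

definition scale_data ::
  "nat \<Rightarrow> nat \<Rightarrow> (nat \<Rightarrow> nat \<Rightarrow> 'x set) \<Rightarrow> (nat \<Rightarrow> 'x \<Rightarrow> 'x) \<Rightarrow> nat \<Rightarrow> bool" where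
  "scale_data C \<rho> D \<pi> R \<longleftrightarrow>
    (\<forall>j \<sigma>. D j \<sigma> \<in> sets X) \<and>
    (\<forall>x\<in>space X. \<exists>j<C. x \<in> D j \<rho>) \<and>
    (\<forall>j \<sigma> k x y. x \<in> D j \<sigma> \<and> y \<in> space X \<and> near k x y \<and> \<sigma> + k \<le> 2 * \<rho> \<longrightarrow> y \<in> D j (\<sigma> + k)) \<and>
    (\<forall>j. \<pi> j \<in> measurable X X) \<and>
    (\<forall>j. \<forall>x\<in>space X. \<exists>a\<le>box R. \<pi> j x = T a x) \<and>
    (\<forall>j x y. x \<in> D j (2 * \<rho>) \<and> y \<in> D j (2 * \<rho>) \<and> near (4 * \<rho>) x y \<longrightarrow> \<pi> j x = \<pi> j y)"

lemma near_same_cell: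
  assumes x: "x \<in> space X" and w: "w \<le> box n" "w' \<le> box n" and "\<rho> > 0"
    and cell: "\<And>i. i \<in> I \<Longrightarrow> w i div \<rho> = w' i div \<rho>"
  shows "near \<rho> (T w x) (T w' x)"
proof -
  define a where "a = (\<lambda>i. max (w i) (w' i) - w i)"
  define b where "b = (\<lambda>i. max (w i) (w' i) - w' i)"
  have zero: "w i = 0" "w' i = 0" if "i \<notin> I" for i
    using w that by (auto simp: le_fun_def box_def split: if_splits)
  have close: "u - v \<le> \<rho>" if "u div \<rho> = v div \<rho>" for u v :: nat
  proof -
    have "u = v div \<rho> * \<rho> + u mod \<rho>" "v = v div \<rho> * \<rho> + v mod \<rho>" using that by (metis div_mult_mod_eq)+
    moreover have "u mod \<rho> < \<rho>" using \<open>\<rho> > 0\<close> by simp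
    ultimately show ?thesis by linarith
  qed
  have "a i \<le> box \<rho> i" "b i \<le> box \<rho> i" for i
    using close[of "w i" "w' i"] close[of "w' i" "w i"] cell[of i] zero[of i]
    by (auto simp: a_def b_def box_def max_def)
  then have "a \<le> box \<rho>" "b \<le> box \<rho>" by (auto simp: le_fun_def)
  moreover have "a + w = b + w'" by (auto simp: a_def b_def fun_eq_iff)
  then have "T a (T w x) = T b (T w' x)" using x by (metis T_add)
  ultimately show ?thesis by (rule nearI)
qed

text \<open>Take \<open>L = 8 * \<rho>\<close>. A point uncovered by all families sees one marker of each family in a window of side
\<open>16 * \<rho>\<close>. The window consists of at most \<open>17 ^ card I\<close> cells of side \<open>\<rho>\<close>, and markers of different
families cannot share a cell, so one family more than there are cells covers everything. The number
of families does not depend on \<open>\<rho>\<close>. The factor \<open>8\<close> leaves room for neighbourhoods of radius \<open>2 * \<rho>\<close>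
whose pieces are still \<open>4 * \<rho>\<close>-separated.\<close>

lemma scale_data_exists:
  assumes \<rho>: "\<rho> > 0"
  shows "\<exists>D \<pi> R. scale_data (17 ^ card I + 1) \<rho> D \<pi> R"
proof -
  define C where "C = (17::nat) ^ card I + 1"
  define L where "L = 8 * \<rho>"
  have "\<rho> \<le> L" by (simp add: L_def)
  from marker_families[OF this, of C] obtain t A where A1: "\<forall>j<C. A j \<in> sets X"
    and A2: "\<forall>j<C. \<forall>x\<in>A j. \<forall>y\<in>A j. near L x y \<longrightarrow> T (box t) x = T (box t) y"
    and A3: "\<forall>j<C. \<forall>j'<C. j \<noteq> j' \<longrightarrow> (\<forall>x\<in>A j. \<forall>y\<in>A j'. \<not> near \<rho> x y)"
    and A4: "\<forall>j<C. \<forall>x\<in>space X. (\<exists>j'<j. \<exists>w. box (L - \<rho>) \<le> w \<and> w \<le> box (L + \<rho>) \<and> T w x \<in> A j') \<or>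
        (\<exists>w\<le>box (2 * L). T w x \<in> A j)"
    by (elim exE conjE)
  note A = A1[rule_format] A2[rule_format] A3[rule_format] A4[rule_format]

  define D where "D = (\<lambda>j \<sigma>. if j < C then {x \<in> space X. \<exists>w\<in>{..box (L + \<sigma>)}. box (L - \<sigma>) \<le> w \<and> T w x \<in> A j} else {})"
  define \<pi> where "\<pi> = (\<lambda>j x. if x \<in> D j (2 * \<rho>) then
     T (box t) (T (SOME w. w \<le> box (L + 2 * \<rho>) \<and> box (L - 2 * \<rho>) \<le> w \<and> T w x \<in> A j) x) else x)"
  have D_sets[measurable]: "D j \<sigma> \<in> sets X" for j \<sigma>
  proof (cases "j < C")
    case True
    have [measurable]: "A j \<in> sets X" using A(1)[OF True] .
    have "Measurable.pred X (\<lambda>x. \<exists>w\<in>{..box (L + \<sigma>)}. box (L - \<sigma>) \<le> w \<and> T w x \<in> A j)"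
      by (intro pred_intros_finite pred_intros_logic finite_box) measurable
    then show ?thesis using True unfolding D_def by simp
  qed (simp add: D_def)
  have sep: "T (box t) (T w x) = T (box t) (T w' y)"
    if j: "j < C" and xy: "x \<in> space X" "y \<in> space X" "near (4 * \<rho>) x y"
      and w: "w \<le> box (L + 2 * \<rho>)" "box (L - 2 * \<rho>) \<le> w" "T w x \<in> A j"
      and w': "w' \<le> box (L + 2 * \<rho>)" "box (L - 2 * \<rho>) \<le> w'" "T w' y \<in> A j" for j x y w w'
  proof (rule A(2)[OF j w(3) w'(3)])
    obtain a b where ab: "a \<le> box (4 * \<rho>)" "b \<le> box (4 * \<rho>)" "T a x = T b y" using xy(3) by (rule nearE)
    define g where "g = box (L - 2 * \<rho>)"
    have diff: "v - g \<le> box (4 * \<rho>)" if "v \<le> box (L + 2 * \<rho>)" for v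
    proof (rule le_funI)
      fix i show "(v - g) i \<le> box (4 * \<rho>) i"
        using le_funD[OF that, of i] by (simp add: g_def box_def L_def split: if_splits)
    qed
    have gw: "w - g + g = w" "w' - g + g = w'" using w(2) w'(2) by (simp_all add: g_def le_fun_diff_add)
    have "(w' - g) + a + w = (w' - g) + (w - g) + g + a"
      by (subst gw(1)[symmetric]) (simp only: ac_simps)
    then have "T ((w' - g) + a) (T w x) = T ((w' - g) + (w - g) + g) (T a x)"
      using xy(1) by (metis T_add)
    also have "\<dots> = T ((w - g) + b) (T w' y)"
    proof -
      have "(w - g) + b + w' = (w' - g) + (w - g) + g + b"
        by (subst gw(2)[symmetric]) (simp only: ac_simps)
      then show ?thesis unfolding ab(3) using xy(2) by (metis T_add)
    qed
    finally have "T ((w' - g) + a) (T w x) = T ((w - g) + b) (T w' y)" .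
    moreover have "(w' - g) + a \<le> box L" "(w - g) + b \<le> box L"
      using box_le_add[OF diff[OF w'(1)] ab(1)] box_le_add[OF diff[OF w(1)] ab(2)] by (simp_all add: L_def)
    ultimately show "near L (T w x) (T w' y)" by (rule nearI[rotated 2])
  qed
  have \<pi>_eq: "\<pi> j x = T (box t) (T w x)"
    if j: "j < C" and x: "x \<in> space X" and w: "w \<le> box (L + 2 * \<rho>)" "box (L - 2 * \<rho>) \<le> w" "T w x \<in> A j" for j x w
  proof -
    have "x \<in> D j (2 * \<rho>)" using j x w by (auto simp: D_def)
    moreover have "\<exists>w. w \<le> box (L + 2 * \<rho>) \<and> box (L - 2 * \<rho>) \<le> w \<and> T w x \<in> A j" using w by blast
    from someI_ex[OF this] have "T (box t) (T (SOME w. w \<le> box (L + 2 * \<rho>) \<and> box (L - 2 * \<rho>) \<le> w \<and> T w x \<in> A j) x)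
      = T (box t) (T w x)"
      by (intro sep[OF j x x near_refl[OF x] _ _ _ w]) auto
    ultimately show ?thesis by (simp add: \<pi>_def)
  qed
  have D_E: "\<exists>w. j < C \<and> x \<in> space X \<and> w \<le> box (L + \<sigma>) \<and> box (L - \<sigma>) \<le> w \<and> T w x \<in> A j"
    if "x \<in> D j \<sigma>" for x j \<sigma>
    using that by (auto simp: D_def split: if_splits)
  have "scale_data C \<rho> D \<pi> (t + (L + 2 * \<rho>))"
    unfolding scale_data_def
  proof (intro conjI allI ballI impI)
    fix x assume x: "x \<in> space X"
    show "\<exists>j<C. x \<in> D j \<rho>"
    proof (rule ccontr)
      assume neg: "\<not> (\<exists>j<C. x \<in> D j \<rho>)"
      have not_D: "\<not> (\<exists>j'<j. \<exists>w. box (L - \<rho>) \<le> w \<and> w \<le> box (L + \<rho>) \<and> T w x \<in> A j')" if "j < C" for j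
      proof
        assume "\<exists>j'<j. \<exists>w. box (L - \<rho>) \<le> w \<and> w \<le> box (L + \<rho>) \<and> T w x \<in> A j'"
        then obtain j' w where "j' < j" "box (L - \<rho>) \<le> w" "w \<le> box (L + \<rho>)" "T w x \<in> A j'" by blast
        then have "x \<in> D j' \<rho>" "j' < C" using x that by (auto simp: D_def)
        then show False using neg by blast
      qed
      have "\<forall>j\<in>{..<C}. \<exists>w\<le>box (2 * L). T w x \<in> A j"
        using A(4)[OF _ x] not_D by blast
      then obtain w where w: "\<And>j. j < C \<Longrightarrow> w j \<le> box (2 * L)" "\<And>j. j < C \<Longrightarrow> T (w j) x \<in> A j"
        using bchoice[of "{..<C}" "\<lambda>j w. w \<le> box (2 * L) \<and> T w x \<in> A j"] by auto
      define cell where "cell = (\<lambda>j. \<lambda>i\<in>I. w j i div \<rho>)"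
      have "cell ` {..<C} \<subseteq> PiE I (\<lambda>_. {..16})"
      proof (rule image_subsetI)
        fix j assume "j \<in> {..<C}"
        then have "j < C" by simp
        have "w j i div \<rho> \<le> 16" if "i \<in> I" for i
        proof -
          have "w j i \<le> 16 * \<rho>" using le_funD[OF w(1)[OF \<open>j < C\<close>], of i] that by (simp add: box_def L_def)
          then show ?thesis using \<rho> by (metis div_le_mono nonzero_mult_div_cancel_right less_not_refl)
        qed
        then show "cell j \<in> PiE I (\<lambda>_. {..16})" by (auto simp: cell_def)
      qed
      then have "card (cell ` {..<C}) \<le> card (PiE I (\<lambda>_. {..16::nat}))"
        by (intro card_mono finite_PiE finite_I) auto
      also have "\<dots> < card {..<C}" using finite_I by (simp add: card_PiE C_def)
      finally have "\<not> inj_on cell {..<C}" by (metis card_image less_irrefl)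
      then obtain j j' where jj': "j < C" "j' < C" "j \<noteq> j'" "cell j = cell j'" by (auto simp: inj_on_def)
      have "near \<rho> (T (w j) x) (T (w j') x)"
      proof (rule near_same_cell[OF x w(1) w(1) \<rho>])
        fix i assume "i \<in> I"
        then show "w j i div \<rho> = w j' i div \<rho>" using fun_cong[OF jj'(4), of i] by (simp add: cell_def)
      qed (use jj' in auto)
      then show False using A(3) w(2) jj' by blast
    qed
  next
    fix j \<sigma> k x y assume *: "x \<in> D j \<sigma> \<and> y \<in> space X \<and> near k x y \<and> \<sigma> + k \<le> 2 * \<rho>"
    then obtain w where w: "j < C" "x \<in> space X" "w \<le> box (L + \<sigma>)" "box (L - \<sigma>) \<le> w" "T w x \<in> A j"
      using D_E by blast
    obtain a b where ab: "a \<le> box k" "b \<le> box k" "T a x = T b y" using * nearE by metis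
    have "\<sigma> + k \<le> 2 * \<rho>" using * by blast
    then have "box k \<le> box (L - \<sigma>)" unfolding L_def by (intro box_mono) linarith
    then have aw: "a \<le> w" using ab(1) w(4) by order
    have "T (w - a + b) y = T (w - a) (T a x)" using * ab(3) by (simp add: T_add)
    also have "\<dots> = T w x" using w(2) aw by (simp add: T_add[symmetric] le_fun_diff_add)
    finally have "T (w - a + b) y \<in> A j" using w(5) by simp
    moreover have "w - a + b \<le> box (L + (\<sigma> + k))"
    proof (rule le_funI)
      fix i show "(w - a + b) i \<le> box (L + (\<sigma> + k)) i"
        using le_funD[OF w(3), of i] le_funD[OF ab(2), of i] by (simp add: box_def split: if_splits)
    qed
    moreover have "box (L - (\<sigma> + k)) \<le> w - a + b"
    proof (rule le_funI)
      fix i show "box (L - (\<sigma> + k)) i \<le> (w - a + b) i"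
        using le_funD[OF w(4), of i] le_funD[OF ab(1), of i] by (simp add: box_def split: if_splits)
    qed
    ultimately show "y \<in> D j (\<sigma> + k)" using w(1) * by (auto simp: D_def)
  next
    fix j
    show "\<pi> j \<in> measurable X X"
    proof (rule measurableI)
      fix x assume "x \<in> space X" then show "\<pi> j x \<in> space X" by (simp add: \<pi>_def)
    next
      fix S assume S[measurable]: "S \<in> sets X"
      show "\<pi> j -` S \<inter> space X \<in> sets X"
      proof (cases "j < C")
        case True
        have "\<pi> j -` S \<inter> space X = {x \<in> space X. (\<exists>w\<in>{..box (L + 2 * \<rho>)}. box (L - 2 * \<rho>) \<le> w \<and> T w x \<in> A j \<and>
             T (box t) (T w x) \<in> S)} \<union> (S - D j (2 * \<rho>))" (is "_ = ?E \<union> _")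
        proof (intro equalityI subsetI)
          fix x assume x: "x \<in> \<pi> j -` S \<inter> space X"
          show "x \<in> ?E \<union> (S - D j (2 * \<rho>))"
          proof (cases "x \<in> D j (2 * \<rho>)")
            case True
            then show ?thesis using D_E[OF True] \<pi>_eq[of j x] x by auto
          qed (use x in \<open>auto simp: \<pi>_def\<close>)
        next
          fix x assume "x \<in> ?E \<union> (S - D j (2 * \<rho>))"
          then consider w where "x \<in> space X" "w \<le> box (L + 2 * \<rho>)" "box (L - 2 * \<rho>) \<le> w" "T w x \<in> A j"
              "T (box t) (T w x) \<in> S" | "x \<in> S" "x \<notin> D j (2 * \<rho>)" by blast
          then show "x \<in> \<pi> j -` S \<inter> space X"
          proof cases
            case 1
            then show ?thesis using \<pi>_eq[OF True, of x w] by simp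
          next
            case 2
            then show ?thesis using sets.sets_into_space[OF S] by (auto simp: \<pi>_def)
          qed
        qed
        moreover have [measurable]: "A j \<in> sets X" using A(1)[OF True] .
        have "Measurable.pred X (\<lambda>x. \<exists>w\<in>{..box (L + 2 * \<rho>)}. box (L - 2 * \<rho>) \<le> w \<and> T w x \<in> A j \<and>
             T (box t) (T w x) \<in> S)"
          by (intro pred_intros_finite pred_intros_logic finite_box) measurable
        then have "?E \<in> sets X" by simp
        ultimately show ?thesis by auto
      next
        case False
        then have "\<pi> j = (\<lambda>x. x)" by (auto simp: \<pi>_def D_def)
        then show ?thesis using S by auto
      qed
    qed
    fix x assume x: "x \<in> space X"
    show "\<exists>a\<le>box (t + (L + 2 * \<rho>)). \<pi> j x = T a x"
    proof (cases "x \<in> D j (2 * \<rho>)")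
      case True
      then obtain w where w: "j < C" "w \<le> box (L + 2 * \<rho>)" "box (L - 2 * \<rho>) \<le> w" "T w x \<in> A j"
        using D_E by blast
      then have "\<pi> j x = T (box t + w) x" using \<pi>_eq[OF w(1) x w(2-)] x by (simp add: T_add)
      then show ?thesis using box_le_add[OF order_refl w(2)] by blast
    next
      case False
      then have "\<pi> j x = T 0 x" using x by (simp add: \<pi>_def)
      then show ?thesis using zero_le_box by blast
    qed
  next
    fix j x y assume *: "x \<in> D j (2 * \<rho>) \<and> y \<in> D j (2 * \<rho>) \<and> near (4 * \<rho>) x y"
    obtain w where w: "j < C" "x \<in> space X" "w \<le> box (L + 2 * \<rho>)" "box (L - 2 * \<rho>) \<le> w" "T w x \<in> A j"
      using D_E * by blast
    obtain w' where w': "y \<in> space X" "w' \<le> box (L + 2 * \<rho>)" "box (L - 2 * \<rho>) \<le> w'" "T w' y \<in> A j"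
      using D_E * by blast
    show "\<pi> j x = \<pi> j y"
      using sep[OF w(1,2) w'(1) _ w(3-) w'(2-)] * \<pi>_eq[OF w(1,2) w(3-)] \<pi>_eq[OF w(1) w'(1) w'(2-)] by simp
  qed (fact D_sets)
  then show ?thesis unfolding C_def by blast
qed

end

section \<open>Walls from nested pieces\<close>

context commuting_maps
begin

lemma near_1_unit: "x \<in> space X \<Longrightarrow> i \<in> I \<Longrightarrow> near 1 x (T (unit i) x)"
  by (rule near_T[OF _ unit_le_box])

text \<open>The sets \<open>D n\<close> of a single family at rapidly growing scales yield a coloring that is proper at all
points which they contain infinitely often. The map \<open>p n\<close> collapses the pieces of the stages before \<open>n\<close> to their
markers, so stage \<open>n\<close> acts on whole earlier pieces: a point joins a piece of stage \<open>n\<close> if its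
representative \<open>p n x\<close> lies in \<open>D n (2 * \<rho> n)\<close>. The number \<open>b n\<close> bounds the displacement by \<open>p n\<close>,
so neighbours have representatives at distance at most \<open>\<delta> n = 2 * b n + 1\<close>. The sets \<open>core i n\<close> are
concentric versions of the pieces whose layers have this width, so a step along an edge changes \<open>i\<close>
by at most one; the constants in \<open>\<rho> n\<close> provide room for six layers below the radius \<open>2 * \<rho> n\<close>.\<close>

lemma toast_coloring:
  fixes D :: "nat \<Rightarrow> nat \<Rightarrow> 'x set" and \<pi> :: "nat \<Rightarrow> 'x \<Rightarrow> 'x" and \<rho> R b :: "nat \<Rightarrow> nat"
  assumes D_sets[measurable]: "\<And>n \<sigma>. D n \<sigma> \<in> sets X"
    and D_near: "\<And>n \<sigma> m x y. \<lbrakk>x \<in> D n \<sigma>; y \<in> space X; near m x y; \<sigma> + m \<le> 2 * \<rho> n\<rbrakk> \<Longrightarrow> y \<in> D n (\<sigma> + m)"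
    and \<pi>_meas[measurable]: "\<And>n. \<pi> n \<in> measurable X X"
    and \<pi>_T: "\<And>n x. x \<in> space X \<Longrightarrow> \<exists>a\<le>box (R n). \<pi> n x = T a x"
    and \<pi>_eq: "\<And>n x y. \<lbrakk>x \<in> D n (2 * \<rho> n); y \<in> D n (2 * \<rho> n); near (4 * \<rho> n) x y\<rbrakk> \<Longrightarrow> \<pi> n x = \<pi> n y"
    and b: "b 0 = 0" "\<And>n. b (Suc n) = b n + R n"
    and \<rho>: "\<And>n. \<rho> n = n + 13 * b n + 6"
    and k: "k > 0"
    and col: "\<And>x. x \<in> space X \<Longrightarrow> col x < k"
      "\<And>x i. \<lbrakk>x \<in> space X; i \<in> I; T (unit i) x \<noteq> x\<rbrakk> \<Longrightarrow> col x \<noteq> col (T (unit i) x)"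
  obtains f :: "'x \<Rightarrow> nat" where "f \<in> measurable X (count_space UNIV)"
    "\<And>x. x \<in> space X \<Longrightarrow> f x < 2 * k - 1"
    "\<And>x i m. \<lbrakk>x \<in> space X; i \<in> I; T (unit i) x \<noteq> x; \<forall>N. \<exists>n\<ge>N. x \<in> D n (\<rho> n + m)\<rbrakk>
       \<Longrightarrow> f x \<noteq> f (T (unit i) x)"
proof -
  define p where "p = rec_nat (\<lambda>x. x) (\<lambda>n pn x. if pn x \<in> D n (2 * \<rho> n) then \<pi> n (pn x) else pn x)"
  have p_0: "p 0 x = x" for x by (simp add: p_def)
  have p_Suc: "p (Suc n) x = (if p n x \<in> D n (2 * \<rho> n) then \<pi> n (p n x) else p n x)" for n x
    by (simp add: p_def)
  have p_meas[measurable]: "p n \<in> measurable X X" for n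
  proof (induction n)
    case 0
    then show ?case by (simp add: p_0[abs_def])
  next
    case (Suc n)
    then have [measurable]: "p n \<in> measurable X X" .
    show ?case unfolding p_Suc[abs_def] by measurable
  qed
  have p_space: "p n x \<in> space X" if "x \<in> space X" for n x
    using measurable_space[OF p_meas that] .
  have p_T: "\<exists>a\<le>box (b n). p n x = T a x" if x: "x \<in> space X" for n x
  proof (induction n)
    case 0
    have "p 0 x = T 0 x" using x by (simp only: p_0 T_zero)
    then show ?case using zero_le_box by blast
  next
    case (Suc n)
    then obtain a where a: "a \<le> box (b n)" "p n x = T a x" by blast
    show ?case
    proof (cases "p n x \<in> D n (2 * \<rho> n)")
      case True
      obtain a' where a': "a' \<le> box (R n)" "\<pi> n (p n x) = T a' (p n x)"
        using \<pi>_T p_space[OF x] by blast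
      have "p (Suc n) x = T (a + a') x"
        using True a' a x by (simp add: p_Suc T_add[symmetric] add.commute)
      then show ?thesis using box_le_add[OF a(1) a'(1)] b(2) by metis
    next
      case False
      then have "p (Suc n) x = T a x" using a by (simp add: p_Suc)
      moreover have "a \<le> box (b (Suc n))" using a(1) box_mono[of "b n" "b (Suc n)"] b(2) by force
      ultimately show ?thesis by blast
    qed
  qed
  define \<delta> where "\<delta> = (\<lambda>n. 2 * b n + 1)"
  have p_near: "near (\<delta> n) (p n x) (p n y)" if xy: "x \<in> space X" "y \<in> space X" "near 1 x y" for n x y
  proof -
    have *: "near (b n) x (p n x)" if "x \<in> space X" for x
      using p_T[OF that, of n] near_T[OF that] by metis
    have "near (b n + 1) (p n x) y" using near_trans[OF near_sym[OF *[OF xy(1)]] xy(3)] xy p_space by blast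
    then have "near (b n + 1 + b n) (p n x) (p n y)" using near_trans[OF _ *[OF xy(2)]] xy p_space by blast
    then show ?thesis by (simp add: \<delta>_def mult_2)
  qed
  define core where "core = (\<lambda>i n. {x \<in> space X. p n x \<in> D n (2 * \<rho> n - i * \<delta> n)})"
  have core_sets[measurable]: "core i n \<in> sets X" for i n unfolding core_def by measurable
  have core_space: "x \<in> space X" if "x \<in> core i n" for x i n using that by (simp add: core_def)
  have core_step: "y \<in> core i n" if "x \<in> core (Suc i) n" "y \<in> space X" "near 1 x y" "i < 6" for x y i n
  proof -
    have *: "Suc i * \<delta> n \<le> 2 * \<rho> n"
    proof -
      have "Suc i * \<delta> n \<le> 6 * \<delta> n" using \<open>i < 6\<close> by (intro mult_le_mono1) simp
      also have "\<dots> \<le> 2 * \<rho> n" by (simp add: \<delta>_def \<rho>)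
      finally show ?thesis .
    qed
    then have "2 * \<rho> n - i * \<delta> n = 2 * \<rho> n - Suc i * \<delta> n + \<delta> n" by simp
    moreover have "p n y \<in> D n (2 * \<rho> n - Suc i * \<delta> n + \<delta> n)"
      using that * p_near[of x y n] core_space[OF that(1)] p_space
      by (intro D_near[of "p n x"]) (auto simp: core_def)
    ultimately show ?thesis using that(2) by (simp add: core_def)
  qed
  have core_Suc: "x \<in> core i n" if "x \<in> core (Suc i) n" "i < 6" for x i n
    using core_step[OF that(1) _ near_refl that(2)] core_space[OF that(1)] by blast
  have core_mono: "x \<in> core i n" if "x \<in> core i' n" "i \<le> i'" "i' \<le> 6" for x i i' n
    using that(2,1,3)
  proof (induction rule: dec_induct)
    case (step m)
    then show ?case using core_Suc[of x m n] by simp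
  qed
  have p_merge: "p (Suc n) x = p (Suc n) y" if "x \<in> core 0 n" "y \<in> core 0 n" "near 1 x y" for x y n
  proof -
    have "near (4 * \<rho> n) (p n x) (p n y)"
      using near_mono[OF p_near[of x y n]] that core_space by (auto simp: \<delta>_def \<rho>)
    then show ?thesis using that \<pi>_eq by (simp add: p_Suc core_def)
  qed
  have p_persist: "p m x = p m y" if "p n x = p n y" "n \<le> m" for x y n m
    using that(2) by (induction rule: dec_induct) (simp_all add: that(1) p_Suc)
  have core_persist: "x \<in> core i m \<longleftrightarrow> y \<in> core i m"
    if "p n x = p n y" "n \<le> m" "x \<in> space X" "y \<in> space X" for x y n m i
    using p_persist[OF that(1,2)] that(3,4) by (simp add: core_def)
  have core_ex: "\<exists>n. x \<in> core 5 n" if x: "x \<in> space X" and inf: "\<forall>N. \<exists>n\<ge>N. x \<in> D n (\<rho> n + m)" for x m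
  proof -
    obtain n where n: "n \<ge> m" "x \<in> D n (\<rho> n + m)" using inf by blast
    obtain a where "a \<le> box (b n)" "p n x = T a x" using p_T[OF x] by blast
    then have nr: "near (b n) x (p n x)" using near_T[OF x] by metis
    have eq: "2 * \<rho> n - 5 * \<delta> n = \<rho> n + m + (\<rho> n - m - 5 * \<delta> n)" "b n \<le> \<rho> n - m - 5 * \<delta> n"
      using n(1) by (simp_all add: \<rho> \<delta>_def)
    have "p n x \<in> D n (\<rho> n + m + (\<rho> n - m - 5 * \<delta> n))"
      using n eq near_mono[OF nr eq(2)] p_space[OF x] by (intro D_near[OF n(2)]) auto
    then have "p n x \<in> D n (2 * \<rho> n - 5 * \<delta> n)" by (simp only: eq(1))
    then show ?thesis using x by (auto simp: core_def)
  qed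
  (* An edge that leaves core 5 n does not lie inside an earlier piece, so its outer end avoids
     core 1 m for m < n. Walls satisfy just this, and neighbours of walls avoid core 2 m. *)
  define Wall where "Wall = (\<lambda>n. {x \<in> space X. x \<in> core 4 n \<and> x \<notin> core 5 n \<and> (\<forall>m\<in>{..<n}. x \<notin> core 1 m)})"
  define Band where "Band = (\<lambda>n. {x \<in> space X. x \<in> core 3 n \<and> x \<notin> core 6 n \<and> (\<forall>m\<in>{..<n}. x \<notin> core 2 m)})"
  have [measurable]: "Wall n \<in> sets X" "Band n \<in> sets X" for n
    unfolding Wall_def Band_def by measurable
  have wall_band: "y \<in> Band n" if xy: "x \<in> Wall n" "y \<in> space X" "near 1 x y" for x y n
  proof -
    have x: "x \<in> space X" "x \<in> core 4 n" "x \<notin> core 5 n" "\<And>m. m < n \<Longrightarrow> x \<notin> core 1 m"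
      using xy(1) by (auto simp: Wall_def)
    have nyx: "near 1 y x" using xy(3) by (rule near_sym)
    have "y \<in> core 3 n" using core_step[of x 3 n y] x xy by simp
    moreover have "y \<notin> core 6 n" using core_step[of y 5 n x] x nyx by auto
    moreover have "y \<notin> core 2 m" if "m < n" for m
      using core_step[of y 1 m x] x(1) x(4)[OF that] nyx by (auto simp: numeral_2_eq_2)
    ultimately show ?thesis using xy(2) by (auto simp: Band_def)
  qed
  have Wall_Band: "x \<in> Band n" if "x \<in> Wall n" for x n
    using wall_band[OF that _ near_refl] that by (auto simp: Wall_def)
  (* A neighbour of core 3 n is in core 2 n, which the bands of later stages avoid: pieces of the
     union of all bands stay within a single stage. *)
  have band_less: "\<not> n < m" if "x \<in> Band n" "y \<in> Band m" "near 1 x y" for x y n m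
  proof
    assume "n < m"
    have "y \<in> core 2 n" using core_step[of x 2 n y] that by (auto simp: Band_def numeral_3_eq_3)
    then show False using that(2) \<open>n < m\<close> by (auto simp: Band_def)
  qed
  have band_unique: "n = m" if "x \<in> Band n" "y \<in> Band m" "near 1 x y" for x y n m
    using band_less[OF that] band_less[OF that(2,1) near_sym[OF that(3)]] by simp
  define W where "W = (\<Union>n. Wall n)"
  define Z where "Z = (\<Union>n. Band n)"
  have [measurable]: "W \<in> sets X" "Z \<in> sets X" unfolding W_def Z_def by measurable
  (* Without crossing a wall one cannot leave core 5 n. If the edge lies in an earlier piece, its
     ends have the same representative at stage n. *)
  have stay: "y \<in> core 5 n" if x: "x \<in> core 5 n" and y: "y \<in> space X" "y \<notin> W" and xy: "near 1 x y" for x y n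
  proof (rule ccontr)
    assume y5: "y \<notin> core 5 n"
    have y4: "y \<in> core 4 n" using core_step[of x 4 n y] x y xy by simp
    have "\<exists>m<n. y \<in> core 1 m" using y y4 y5 by (auto simp: W_def Wall_def)
    then obtain m where m: "m < n" "y \<in> core 1 m" by blast
    have "x \<in> core 0 m" using core_step[of y 0 m x] m(2) core_space[OF x] near_sym[OF xy] by simp
    moreover have "y \<in> core 0 m" using core_mono[OF m(2)] by simp
    ultimately have "p (Suc m) x = p (Suc m) y" using p_merge xy by blast
    then have "y \<in> core 5 n" using core_persist[of "Suc m" x y n 5] m(1) x y core_space[OF x] by simp
    then show False using y5 by blast
  qed
  define Room where "Room = (\<lambda>n. {x \<in> space X. x \<in> core 5 n \<and> x \<notin> W \<and> (\<forall>m\<in>{..<n}. x \<notin> core 5 m)})"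
  have [measurable]: "Room n \<in> sets X" for n unfolding Room_def by measurable
  have piecewise: "\<exists>c. c \<in> measurable X (count_space UNIV) \<and> (\<forall>x\<in>space X. c x < k) \<and>
      (\<forall>x\<in>Y. \<forall>i\<in>I. T (unit i) x \<in> Y \<and> p n (T (unit i) x) = p n x \<and> T (unit i) x \<noteq> x \<longrightarrow>
         c x \<noteq> c (T (unit i) x))" if Y: "Y \<in> sets X" for Y n
  proof -
    have "\<exists>a\<le>box (b n). p n x = T a x" if "x \<in> Y" for x
      using p_T sets.sets_into_space[OF Y] that by blast
    then show ?thesis
      by (rule fibrewise_coloring[OF Y p_meas _ k col]) blast+
  qed
  have "\<forall>n. \<exists>c. c \<in> measurable X (count_space UNIV) \<and> (\<forall>x\<in>space X. c x < k) \<and>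
      (\<forall>x\<in>Room n. \<forall>i\<in>I. T (unit i) x \<in> Room n \<and> p (Suc n) (T (unit i) x) = p (Suc n) x \<and>
         T (unit i) x \<noteq> x \<longrightarrow> c x \<noteq> c (T (unit i) x))"
    by (intro allI piecewise) measurable
  from choice[OF this] obtain g where g: "\<forall>n. g n \<in> measurable X (count_space UNIV) \<and> (\<forall>x\<in>space X. g n x < k) \<and>
      (\<forall>x\<in>Room n. \<forall>i\<in>I. T (unit i) x \<in> Room n \<and> p (Suc n) (T (unit i) x) = p (Suc n) x \<and>
         T (unit i) x \<noteq> x \<longrightarrow> g n x \<noteq> g n (T (unit i) x))" by (elim exE)
  have "\<forall>n. \<exists>c. c \<in> measurable X (count_space UNIV) \<and> (\<forall>x\<in>space X. c x < k) \<and>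
      (\<forall>x\<in>Band n. \<forall>i\<in>I. T (unit i) x \<in> Band n \<and> p (Suc n) (T (unit i) x) = p (Suc n) x \<and>
         T (unit i) x \<noteq> x \<longrightarrow> c x \<noteq> c (T (unit i) x))"
    by (intro allI piecewise) measurable
  from choice[OF this] obtain h where h: "\<forall>n. h n \<in> measurable X (count_space UNIV) \<and> (\<forall>x\<in>space X. h n x < k) \<and>
      (\<forall>x\<in>Band n. \<forall>i\<in>I. T (unit i) x \<in> Band n \<and> p (Suc n) (T (unit i) x) = p (Suc n) x \<and>
         T (unit i) x \<noteq> x \<longrightarrow> h n x \<noteq> h n (T (unit i) x))" by (elim exE)
  have [measurable]: "g n \<in> measurable X (count_space UNIV)" "h n \<in> measurable X (count_space UNIV)" for n
    using g h by blast+
  define c0 where "c0 x = g (LEAST n. x \<in> core 5 n) x" for x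
  define c1 where "c1 x = h (LEAST n. x \<in> Band n) x" for x
  have [measurable]: "c0 \<in> measurable X (count_space UNIV)"
    unfolding c0_def[abs_def] by (rule measurable_compose_countable[of g]) measurable
  have [measurable]: "c1 \<in> measurable X (count_space UNIV)"
    unfolding c1_def[abs_def] by (rule measurable_compose_countable[of h]) measurable
  have c_less: "c0 x < k" "c1 x < k" if "x \<in> space X" for x
    using g h that unfolding c0_def c1_def by blast+
  have c0_ne: "c0 x \<noteq> c0 (T (unit i) x)"
    if x: "x \<in> space X" "i \<in> I" "T (unit i) x \<noteq> x" "x \<notin> W" "T (unit i) x \<notin> W" "\<exists>n. x \<in> core 5 n" for x i
  proof -
    define y where "y = T (unit i) x"
    have y: "y \<in> space X" "near 1 x y" "near 1 y x"
      using x near_1_unit near_sym by (auto simp: y_def)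
    have iff: "x \<in> core 5 m \<longleftrightarrow> y \<in> core 5 m" for m
      using stay[of x m y] stay[of y m x] x y by (auto simp: y_def)
    define n where "n = (LEAST n. x \<in> core 5 n)"
    have n: "x \<in> core 5 n" unfolding n_def using x(6) by (rule LeastI_ex)
    have "x \<notin> core 5 m" if "m < n" for m using that unfolding n_def by (rule not_less_Least)
    then have "x \<in> Room n" "y \<in> Room n" using n x y iff by (auto simp: Room_def y_def)
    moreover have "p (Suc n) y = p (Suc n) x"
      using p_merge[of y n x] core_mono[of y 5 n 0] core_mono[of x 5 n 0] n iff y(3) by simp
    ultimately have "g n x \<noteq> g n y" using g x(2,3) unfolding y_def by blast
    then show ?thesis unfolding c0_def y_def[symmetric] iff[symmetric] n_def[symmetric] .
  qed
  have c1_ne: "c1 x \<noteq> c1 (T (unit i) x)"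
    if x: "x \<in> space X" "i \<in> I" "T (unit i) x \<noteq> x" "x \<in> Z" "T (unit i) x \<in> Z" for x i
  proof -
    define y where "y = T (unit i) x"
    have y: "y \<in> space X" "near 1 x y" "near 1 y x"
      using x near_1_unit near_sym by (auto simp: y_def)
    obtain n where n: "x \<in> Band n" using x by (auto simp: Z_def)
    obtain m where m: "y \<in> Band m" using x by (auto simp: Z_def y_def)
    have "n = m" using band_unique[OF n m y(2)] .
    have Lx: "(LEAST n. x \<in> Band n) = n"
      using n band_unique[OF _ n near_refl[OF x(1)]] by (metis LeastI)
    have Ly: "(LEAST n. y \<in> Band n) = n"
      using m \<open>n = m\<close> band_unique[OF _ m near_refl[OF y(1)]] by (metis LeastI)
    have "x \<in> core 3 n" "y \<in> core 3 n" using n m \<open>n = m\<close> by (auto simp: Band_def)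
    then have "p (Suc n) y = p (Suc n) x"
      using p_merge[of y n x] core_mono[of y 3 n 0] core_mono[of x 3 n 0] y(3) by simp
    then have "h n x \<noteq> h n y" using h n m \<open>n = m\<close> x(2,3) unfolding y_def by blast
    then show ?thesis unfolding c1_def y_def[symmetric] Lx Ly .
  qed
  define f where "f x = (if x \<in> W then (if c1 x = 0 then 0 else k - 1 + c1 x)
     else if x \<in> Z then (if c1 x = 0 then c0 x else k - 1 + c1 x) else c0 x)" for x
  show thesis
  proof
    show "f \<in> measurable X (count_space UNIV)" unfolding f_def[abs_def] by measurable
    show "f x < 2 * k - 1" if "x \<in> space X" for x
      using c_less[OF that] k by (auto simp: f_def)
    fix x i m
    assume x: "x \<in> space X" "i \<in> I" "T (unit i) x \<noteq> x" and inf: "\<forall>N. \<exists>n\<ge>N. x \<in> D n (\<rho> n + m)"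
    define y where "y = T (unit i) x"
    have y: "y \<in> space X" "near 1 x y" "near 1 y x"
      using x near_1_unit near_sym by (auto simp: y_def)
    have W: "x \<in> W \<Longrightarrow> x \<in> Z \<and> y \<in> Z" "y \<in> W \<Longrightarrow> x \<in> Z \<and> y \<in> Z"
      using Wall_Band wall_band[of x _ y] wall_band[of y _ x] x(1) y unfolding W_def Z_def by blast+
    have "c0 x \<noteq> c0 y" if "x \<notin> W" "y \<notin> W"
      using c0_ne x core_ex[OF x(1) inf] that unfolding y_def by blast
    moreover have "c1 x \<noteq> c1 y" if "x \<in> Z" "y \<in> Z"
      using c1_ne x that unfolding y_def by blast
    moreover have "c0 x < k" "c0 y < k" using c_less x y by auto
    ultimately show "f x \<noteq> f (T (unit i) x)"
      using W unfolding y_def[symmetric] f_def by (auto split: if_splits)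
  qed
qed

text \<open>A point may lie in sets of every family, but some family contains it at infinitely many scales. If
this is required only up to a constant enlargement, it is a property of the whole component. So the
least such family is constant along edges and its coloring can be used.\<close>

lemma borel_coloring:
  assumes k: "k > 0"
    and col: "\<And>x. x \<in> space X \<Longrightarrow> col x < k"
      "\<And>x i. \<lbrakk>x \<in> space X; i \<in> I; T (unit i) x \<noteq> x\<rbrakk> \<Longrightarrow> col x \<noteq> col (T (unit i) x)"
  obtains f :: "'x \<Rightarrow> nat" where "f \<in> measurable X (count_space UNIV)"
    "\<And>x. x \<in> space X \<Longrightarrow> f x < 2 * k - 1"
    "\<And>x i. \<lbrakk>x \<in> space X; i \<in> I; T (unit i) x \<noteq> x\<rbrakk> \<Longrightarrow> f x \<noteq> f (T (unit i) x)"
proof -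
  define C where "C = (17::nat) ^ card I + 1"
  have "\<forall>\<rho>. \<exists>s. \<rho> > 0 \<longrightarrow> (case s of (D, \<pi>, R) \<Rightarrow> scale_data C \<rho> D \<pi> R)"
    using scale_data_exists unfolding C_def by fastforce
  from choice[OF this] obtain s where
    s: "\<forall>\<rho>. \<rho> > 0 \<longrightarrow> (case s \<rho> of (D, \<pi>, R) \<Rightarrow> scale_data C \<rho> D \<pi> R)" by (elim exE)
  define D where "D \<rho> = fst (s \<rho>)" for \<rho>
  define \<pi> where "\<pi> \<rho> = fst (snd (s \<rho>))" for \<rho>
  define R where "R \<rho> = snd (snd (s \<rho>))" for \<rho>
  have sd: "scale_data C \<rho> (D \<rho>) (\<pi> \<rho>) (R \<rho>)" if "\<rho> > 0" for \<rho>
    using s[rule_format, OF that] unfolding D_def \<pi>_def R_def by (simp add: case_prod_beta)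
  define b where "b = rec_nat 0 (\<lambda>n bn. bn + R (n + 13 * bn + 6))"
  define r where "r n = n + 13 * b n + 6" for n
  have b: "b 0 = 0" "b (Suc n) = b n + R (r n)" for n by (simp_all add: b_def r_def)
  have r: "r n > 0" for n by (simp add: r_def)
  note sd_r = sd[OF r, unfolded scale_data_def]
  have D_sets[measurable]: "D (r n) j \<sigma> \<in> sets X" for n j \<sigma> using sd_r[of n] by blast
  have cover: "\<exists>j<C. x \<in> D (r n) j (r n)" if "x \<in> space X" for x n using sd_r[of n] that by blast
  have D_near: "y \<in> D (r n) j (\<sigma> + m)"
    if "x \<in> D (r n) j \<sigma>" "y \<in> space X" "near m x y" "\<sigma> + m \<le> 2 * r n" for n j \<sigma> m x y
    using sd_r[of n] that by blast
  have "\<exists>f. f \<in> measurable X (count_space UNIV) \<and> (\<forall>x\<in>space X. f x < 2 * k - 1) \<and>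
     (\<forall>x\<in>space X. \<forall>i\<in>I. \<forall>m. T (unit i) x \<noteq> x \<and> (\<forall>N. \<exists>n\<ge>N. x \<in> D (r n) j (r n + m)) \<longrightarrow>
        f x \<noteq> f (T (unit i) x))" for j
  proof -
    show ?thesis
    proof (rule toast_coloring[of "\<lambda>n. D (r n) j" r "\<lambda>n. \<pi> (r n) j" "\<lambda>n. R (r n)" b k col])
      show "D (r n) j \<sigma> \<in> sets X" for n \<sigma> by (rule D_sets)
    next
      fix n \<sigma> m x y
      assume "x \<in> D (r n) j \<sigma>" "y \<in> space X" "near m x y" "\<sigma> + m \<le> 2 * r n"
      then show "y \<in> D (r n) j (\<sigma> + m)" by (rule D_near)
    next
      show "\<pi> (r n) j \<in> measurable X X" for n using sd_r[of n] by blast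
    next
      show "\<exists>a\<le>box (R (r n)). \<pi> (r n) j x = T a x" if "x \<in> space X" for n x using sd_r[of n] that by blast
    next
      show "\<pi> (r n) j x = \<pi> (r n) j y"
        if "x \<in> D (r n) j (2 * r n)" "y \<in> D (r n) j (2 * r n)" "near (4 * r n) x y" for n x y
        using sd_r[of n] that by blast
    next
      show "r n = n + 13 * b n + 6" for n by (rule r_def)
    qed (use b k col in blast)+
  qed
  then have "\<forall>j. \<exists>f. f \<in> measurable X (count_space UNIV) \<and> (\<forall>x\<in>space X. f x < 2 * k - 1) \<and>
     (\<forall>x\<in>space X. \<forall>i\<in>I. \<forall>m. T (unit i) x \<noteq> x \<and> (\<forall>N. \<exists>n\<ge>N. x \<in> D (r n) j (r n + m)) \<longrightarrow>
        f x \<noteq> f (T (unit i) x))" by blast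
  from choice[OF this] obtain f where f: "\<forall>j. f j \<in> measurable X (count_space UNIV) \<and>
     (\<forall>x\<in>space X. f j x < 2 * k - 1) \<and>
     (\<forall>x\<in>space X. \<forall>i\<in>I. \<forall>m. T (unit i) x \<noteq> x \<and> (\<forall>N. \<exists>n\<ge>N. x \<in> D (r n) j (r n + m)) \<longrightarrow>
        f j x \<noteq> f j (T (unit i) x))" by (elim exE)
  define J where "J = (\<lambda>j x. \<exists>m. \<forall>N. \<exists>n. n \<ge> N \<and> x \<in> D (r n) j (r n + m))"
  have [measurable]: "Measurable.pred X (J j)" for j unfolding J_def by measurable
  have J_near: "J j y" if Jx: "J j x" and xy: "near 1 x y" "y \<in> space X" for j x y
  proof -
    obtain m where m: "\<And>N. \<exists>n. n \<ge> N \<and> x \<in> D (r n) j (r n + m)" using Jx by (auto simp: J_def)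
    have "\<exists>n. n \<ge> N \<and> y \<in> D (r n) j (r n + (m + 1))" for N
    proof -
      obtain n where n: "n \<ge> max N m" "x \<in> D (r n) j (r n + m)" using m by blast
      then have "r n + m + 1 \<le> 2 * r n" by (simp add: r_def)
      from D_near[OF n(2) xy(2,1) this] show ?thesis using n(1) by (auto simp: add.assoc)
    qed
    then show ?thesis unfolding J_def by blast
  qed
  have J_ex: "\<exists>j. J j x" if x: "x \<in> space X" for x
  proof (rule ccontr)
    assume "\<not> ?thesis"
    then have "\<forall>j\<in>{..<C}. \<forall>\<^sub>F n in sequentially. x \<notin> D (r n) j (r n + 0)"
      unfolding J_def eventually_sequentially by blast
    then have "\<forall>\<^sub>F n in sequentially. \<forall>j\<in>{..<C}. x \<notin> D (r n) j (r n + 0)"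
      by (intro eventually_ball_finite) auto
    then obtain n where "\<forall>j\<in>{..<C}. x \<notin> D (r n) j (r n)"
      unfolding eventually_sequentially by auto
    then show False using cover[OF x, of n] by auto
  qed
  have [measurable]: "f j \<in> measurable X (count_space UNIV)" for j using f by blast
  show thesis
  proof
    show "(\<lambda>x. f (LEAST j. J j x) x) \<in> measurable X (count_space UNIV)"
      by (rule measurable_compose_countable[of f]) measurable
    show "f (LEAST j. J j x) x < 2 * k - 1" if "x \<in> space X" for x using f that by blast
    fix x i assume x: "x \<in> space X" "i \<in> I" "T (unit i) x \<noteq> x"
    define y where "y = T (unit i) x"
    have y: "y \<in> space X" "near 1 x y" "near 1 y x"
      using x near_1_unit near_sym by (auto simp: y_def)
    have iff: "J j x \<longleftrightarrow> J j y" for j using J_near[of j x y] J_near[of j y x] x y by blast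
    define j where "j = (LEAST j. J j x)"
    have "J j x" unfolding j_def using J_ex[OF x(1)] by (rule LeastI_ex)
    then obtain m where "\<forall>N. \<exists>n\<ge>N. x \<in> D (r n) j (r n + m)" by (auto simp: J_def)
    then have "f j x \<noteq> f j y" using f x unfolding y_def by blast
    then show "f (LEAST j. J j x) x \<noteq> f (LEAST j. J j (T (unit i) x)) (T (unit i) x)"
      unfolding y_def[symmetric] iff[symmetric] j_def[symmetric] .
  qed
qed

end

section \<open>Actions of commutative monoids\<close>

lemma monoid_action_borel_coloring:
  fixes M :: "'m monoid" and X :: "'x measure"
  assumes M: "Group.comm_monoid M" and S: "S \<subseteq> carrier M" "finite S"
    and act: "borel_mset M X act" and bnd: "bounded_to_one M X act" and k: "k > 0"
    and c: "proper_coloring (space X) (schreier_graph S X act) k c"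
  shows "\<exists>f. borel_proper_coloring X (schreier_graph S X act) (2 * k - 1) f"
proof -
  interpret comm_monoid M by (rule M)
  interpret A: borel_mset M X act by (rule act)
  define el where "el (a :: 'm \<Rightarrow> nat) = finprod M (\<lambda>s. s [^]\<^bsub>M\<^esub> a s) S" for a
  define T where "T a = act (el a)" for a
  have pow: "(\<lambda>s. s [^]\<^bsub>M\<^esub> (a s :: nat)) \<in> S \<rightarrow> carrier M" for a using S(1) by auto
  have el: "el a \<in> carrier M" for a unfolding el_def by (rule finprod_closed[OF pow])
  have el_add: "el (a + b) = el a \<otimes>\<^bsub>M\<^esub> el b" for a b
  proof -
    have "el (a + b) = finprod M (\<lambda>s. s [^]\<^bsub>M\<^esub> a s \<otimes>\<^bsub>M\<^esub> s [^]\<^bsub>M\<^esub> b s) S"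
      unfolding el_def using S(1) by (intro finprod_cong') (auto simp: nat_pow_mult)
    also have "\<dots> = el a \<otimes>\<^bsub>M\<^esub> el b" unfolding el_def by (rule finprod_multf[OF pow pow])
    finally show ?thesis .
  qed
  have el_0: "el 0 = \<one>\<^bsub>M\<^esub>" unfolding el_def by simp
  interpret C: commuting_maps X S T
  proof
    show "standard_borel X" by (rule A.standard_borel)
    show "T a \<in> measurable X X" for a unfolding T_def by (rule A.act_borel[OF el])
    show "T 0 x = x" if "x \<in> space X" for x using that by (simp add: T_def el_0 A.act_one)
    show "T (a + b) x = T a (T b x)" if "x \<in> space X" for a b x
      using that el by (simp add: T_def el_add A.act_mult)
    show "\<exists>b. \<forall>y\<in>space X. finite {x \<in> space X. T a x = y} \<and> card {x \<in> space X. T a x = y} \<le> b" for a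
      using bnd el unfolding bounded_to_one_def T_def by blast
  qed (rule S(2))
  have T_unit: "T (C.unit s) = act s" if "s \<in> S" for s
  proof -
    have "el (C.unit s) = finprod M (\<lambda>t. if s = t then t else \<one>\<^bsub>M\<^esub>) S"
      unfolding el_def C.unit_def using S(1) by (intro finprod_cong') auto
    also have "\<dots> = s" using that S by (intro finprod_singleton) auto
    finally show ?thesis by (simp add: T_def)
  qed
  have edge: "(x, act s x) \<in> schreier_graph S X act" if "x \<in> space X" "s \<in> S" "act s x \<noteq> x" for x s
    using that C.T_space[of x "C.unit s"] by (auto simp: schreier_graph_def T_unit)
  have "c x < k" if "x \<in> space X" for x using c that by (auto simp: proper_coloring_def)
  moreover have "c x \<noteq> c (T (C.unit s) x)" if "x \<in> space X" "s \<in> S" "T (C.unit s) x \<noteq> x" for x s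
    using c edge[of x s] that by (auto simp: proper_coloring_def T_unit)
  ultimately obtain f where f: "f \<in> measurable X (count_space UNIV)"
    "\<And>x. x \<in> space X \<Longrightarrow> f x < 2 * k - 1"
    "\<And>x s. \<lbrakk>x \<in> space X; s \<in> S; T (C.unit s) x \<noteq> x\<rbrakk> \<Longrightarrow> f x \<noteq> f (T (C.unit s) x)"
    using C.borel_coloring[OF k, of c] by blast
  have "f x \<noteq> f y" if "(x, y) \<in> schreier_graph S X act" for x y
  proof -
    from that obtain s where "s \<in> S" "y = T (C.unit s) x \<or> x = T (C.unit s) y" "x \<noteq> y"
      "x \<in> space X" "y \<in> space X" by (auto simp: schreier_graph_def T_unit)
    then show ?thesis using f(3) by metis
  qed
  then have "proper_coloring (space X) (schreier_graph S X act) (2 * k - 1) f"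
    using f(2) by (auto simp: proper_coloring_def)
  moreover have "f \<in> measurable X (count_space {..<2 * k - 1})"
  proof -
    have "f -` {a} \<inter> space X \<in> sets X" for a using f(1) by (rule measurable_sets) simp
    then show ?thesis using f(2) by (simp add: measurable_count_space_eq2)
  qed
  ultimately show ?thesis unfolding borel_proper_coloring_def by blast
qed

text \<open>Points with a common forward image form an equivalence class; fix a representative \<open>z\<close> of each. If
\<open>v x = w z\<close>, the parity of the total length of \<open>v\<close> and \<open>w\<close> depends on \<open>x\<close> only, because comparing two
such pairs gives two tuples which agree at \<open>z\<close> and hence are equal by freeness. A generator changes
this parity.\<close>

lemma free_nat_tuples_two_coloring:
  assumes act: "borel_mset (nat_tuples d) X act" and free: "free_action (nat_tuples d) X act"
  shows "\<exists>c. proper_coloring (space X) (schreier_graph (std_generator d ` {..<d}) X act) 2 c"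
proof -
  let ?M = "nat_tuples d"
  interpret comm_monoid ?M by (rule comm_monoid_nat_tuples)
  interpret A: borel_mset ?M X act by (rule act)
  define len where "len v = (\<Sum>i<d. v i)" for v :: "nat \<Rightarrow> nat"
  have len_mult: "len (v \<otimes>\<^bsub>?M\<^esub> w) = len v + len w" for v w
    by (simp add: len_def nat_tuples_def sum.distrib)
  have len_gen: "len (std_generator d i) = 1" if "i < d" for i
    using that by (simp add: len_def std_generator_def)
  have gen: "std_generator d i \<in> carrier ?M" for i by (rule std_generator_in_nat_tuples)
  define E where "E x y \<longleftrightarrow> (\<exists>v\<in>carrier ?M. \<exists>w\<in>carrier ?M. act v x = act w y)" for x y
  have E_refl: "E x x" for x unfolding E_def using one_closed by blast
  have act_space: "act v x \<in> space X" if "v \<in> carrier ?M" "x \<in> space X" for v x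
    using measurable_space[OF A.act_borel[OF that(1)] that(2)] .
  have E_act: "E x z \<longleftrightarrow> E (act s x) z" if s: "s \<in> carrier ?M" and x: "x \<in> space X" "z \<in> space X" for s x z
  proof
    assume "E x z"
    then obtain v w where vw: "v \<in> carrier ?M" "w \<in> carrier ?M" "act v x = act w z" unfolding E_def by blast
    have "act v (act s x) = act (s \<otimes>\<^bsub>?M\<^esub> v) x" using vw s x by (simp add: A.act_mult[symmetric] m_comm)
    also have "\<dots> = act (s \<otimes>\<^bsub>?M\<^esub> w) z" using vw s x by (simp add: A.act_mult)
    finally have "act v (act s x) = act (s \<otimes>\<^bsub>?M\<^esub> w) z" .
    then show "E (act s x) z" unfolding E_def using vw s by blast
  next
    assume "E (act s x) z"
    then obtain v w where vw: "v \<in> carrier ?M" "w \<in> carrier ?M" "act v (act s x) = act w z" unfolding E_def by blast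
    then have "act (v \<otimes>\<^bsub>?M\<^esub> s) x = act w z" using s x by (simp add: A.act_mult)
    then show "E x z" unfolding E_def using vw s by blast
  qed
  define rep where "rep x = (SOME z. z \<in> space X \<and> E x z)" for x
  have rep: "rep x \<in> space X" "E x (rep x)" if "x \<in> space X" for x
    using someI[of "\<lambda>z. z \<in> space X \<and> E x z" x] E_refl that unfolding rep_def by auto
  have rep_act: "rep (act s x) = rep x" if "s \<in> carrier ?M" "x \<in> space X" for s x
  proof -
    have "(\<lambda>z. z \<in> space X \<and> E (act s x) z) = (\<lambda>z. z \<in> space X \<and> E x z)"
      using E_act[OF that] by blast
    then show ?thesis by (simp add: rep_def)
  qed
  define P where "P x n \<longleftrightarrow> (\<exists>v\<in>carrier ?M. \<exists>w\<in>carrier ?M. act v x = act w (rep x) \<and> n = (len v + len w) mod 2)" for x n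
  have P_unique: "m = n" if x: "x \<in> space X" and P: "P x m" "P x n" for x m n
  proof -
    obtain v w where vw: "v \<in> carrier ?M" "w \<in> carrier ?M" "act v x = act w (rep x)" "m = (len v + len w) mod 2"
      using P(1) unfolding P_def by blast
    obtain v' w' where vw': "v' \<in> carrier ?M" "w' \<in> carrier ?M" "act v' x = act w' (rep x)" "n = (len v' + len w') mod 2"
      using P(2) unfolding P_def by blast
    have z: "rep x \<in> space X" using rep(1)[OF x] .
    have "act (v' \<otimes>\<^bsub>?M\<^esub> w) (rep x) = act v' (act v x)" using vw vw' z by (simp add: A.act_mult)
    also have "\<dots> = act (v' \<otimes>\<^bsub>?M\<^esub> v) x" using vw vw' x by (simp add: A.act_mult)
    also have "\<dots> = act (v \<otimes>\<^bsub>?M\<^esub> v') x" using vw vw' by (simp add: m_comm)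
    also have "\<dots> = act v (act v' x)" using vw vw' x by (simp add: A.act_mult)
    also have "\<dots> = act (v \<otimes>\<^bsub>?M\<^esub> w') (rep x)" using vw vw' z by (simp add: A.act_mult)
    finally have "v' \<otimes>\<^bsub>?M\<^esub> w = v \<otimes>\<^bsub>?M\<^esub> w'"
      by (rule free[unfolded free_action_def, rule_format, OF z m_closed[OF vw'(1) vw(2)] m_closed[OF vw(1) vw'(2)]])
    then have "len (v' \<otimes>\<^bsub>?M\<^esub> w) = len (v \<otimes>\<^bsub>?M\<^esub> w')" by (rule arg_cong)
    then have "len v' + len w = len v + len w'" unfolding len_mult .
    moreover have parity: "a' + b = a + b' \<Longrightarrow> (a + b) mod 2 = (a' + b') mod 2" for a b a' b' :: nat
    proof -
      assume "a' + b = a + b'"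
      then have "a + b + 2 * b' = a' + b' + 2 * b" by simp
      then have "(a + b + 2 * b') mod 2 = (a' + b' + 2 * b) mod 2" by (rule arg_cong)
      then show "(a + b) mod 2 = (a' + b') mod 2" by simp
    qed
    ultimately show ?thesis unfolding vw(4) vw'(4) by (intro parity)
  qed
  define c where "c x = (SOME n. P x n)" for x
  have Pc: "P x (c x)" if x: "x \<in> space X" for x
  proof -
    have "\<exists>n. P x n" using rep(2)[OF x] unfolding E_def P_def by blast
    then show ?thesis unfolding c_def by (rule someI_ex)
  qed
  have c_ne: "c x \<noteq> c (act (std_generator d i) x)" if x: "x \<in> space X" and i: "i < d" for x i
  proof -
    let ?s = "std_generator d i"
    obtain v w where vw: "v \<in> carrier ?M" "w \<in> carrier ?M" "act v x = act w (rep x)" "c x = (len v + len w) mod 2"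
      using Pc[OF x] unfolding P_def by blast
    have "act v (act ?s x) = act (?s \<otimes>\<^bsub>?M\<^esub> v) x" using vw gen x by (simp add: A.act_mult[symmetric] m_comm)
    also have "\<dots> = act (?s \<otimes>\<^bsub>?M\<^esub> w) (rep (act ?s x))"
      unfolding rep_act[OF gen x] using vw gen x rep(1)[OF x] by (simp add: A.act_mult)
    finally have "act v (act ?s x) = act (?s \<otimes>\<^bsub>?M\<^esub> w) (rep (act ?s x))" .
    then have "P (act ?s x) ((len v + len (?s \<otimes>\<^bsub>?M\<^esub> w)) mod 2)"
      unfolding P_def using vw gen m_closed by blast
    then have "c (act ?s x) = (len v + len (?s \<otimes>\<^bsub>?M\<^esub> w)) mod 2"
      using P_unique[OF act_space[OF gen x] Pc[OF act_space[OF gen x]]] by blast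
    also have "\<dots> = Suc (len v + len w) mod 2" using len_mult len_gen[OF i] by simp
    finally have "c (act ?s x) = Suc (len v + len w) mod 2" .
    moreover have "a mod 2 \<noteq> Suc a mod 2" for a :: nat by presburger
    ultimately show ?thesis unfolding vw(4) by metis
  qed
  have "c x < 2" if "x \<in> space X" for x using Pc[OF that] unfolding P_def by auto
  moreover have "c x \<noteq> c y" if "(x, y) \<in> schreier_graph (std_generator d ` {..<d}) X act" for x y
  proof -
    from that obtain i where "i < d" "y = act (std_generator d i) x \<or> x = act (std_generator d i) y"
      "x \<in> space X" "y \<in> space X" by (auto simp: schreier_graph_def)
    then show ?thesis using c_ne by metis
  qed
  ultimately show ?thesis unfolding proper_coloring_def by (intro exI[of _ c]) auto
qed

theorem corollary5p15:
  shows "(\<forall>(M :: 'm monoid) (S :: 'm set) (X :: 'x measure) (act :: 'm \<Rightarrow> 'x \<Rightarrow> 'x) (k :: nat).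
            Group.comm_monoid M \<and> S \<subseteq> carrier M \<and> finite S \<and>
            borel_mset M X act \<and> bounded_to_one M X act \<and> k > 0 \<and>
            (\<exists>c. proper_coloring (space X) (schreier_graph S X act) k c)
            \<longrightarrow> (\<exists>c. borel_proper_coloring X (schreier_graph S X act) (2 * k - 1) c))
       \<and> (\<forall>(d :: nat) (X :: 'x measure) (act :: (nat \<Rightarrow> nat) \<Rightarrow> 'x \<Rightarrow> 'x).
            borel_mset (nat_tuples d) X act \<and> bounded_to_one (nat_tuples d) X act \<and>
            free_action (nat_tuples d) X act
            \<longrightarrow> (\<exists>c. borel_proper_coloring X
                      (schreier_graph (std_generator d ` {..<d}) X act) 3 c))"
proof (intro conjI allI impI)
  fix M :: "'m monoid" and S :: "'m set" and X :: "'x measure" and act :: "'m \<Rightarrow> 'x \<Rightarrow> 'x" and k :: nat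
  assume "Group.comm_monoid M \<and> S \<subseteq> carrier M \<and> finite S \<and>
            borel_mset M X act \<and> bounded_to_one M X act \<and> k > 0 \<and>
            (\<exists>c. proper_coloring (space X) (schreier_graph S X act) k c)"
  then show "\<exists>c. borel_proper_coloring X (schreier_graph S X act) (2 * k - 1) c"
    using monoid_action_borel_coloring by blast
next
  fix d :: nat and X :: "'x measure" and act :: "(nat \<Rightarrow> nat) \<Rightarrow> 'x \<Rightarrow> 'x"
  assume *: "borel_mset (nat_tuples d) X act \<and> bounded_to_one (nat_tuples d) X act \<and>
            free_action (nat_tuples d) X act"
  then obtain c where c: "proper_coloring (space X) (schreier_graph (std_generator d ` {..<d}) X act) 2 c"
    using free_nat_tuples_two_coloring by blast
  have "std_generator d ` {..<d} \<subseteq> carrier (nat_tuples d)" using std_generator_in_nat_tuples by auto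
  from monoid_action_borel_coloring[OF comm_monoid_nat_tuples this _ _ _ _ c] *
  show "\<exists>c. borel_proper_coloring X (schreier_graph (std_generator d ` {..<d}) X act) 3 c" by simp
qed

end
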